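(* Assume the NFA Acceptance hypothesis. Then the Word Break problem has no $O(n m^{1/3-\varepsilon}+m)$-time algorithm for any $\varepsilon>0$. This even holds when restricted to instances with $m=\Theta(n^\gamma)$, for any constant $\gamma\in(0,3/2)$.
   Context: Word Break: given a string $S$ and a dictionary $D$ (a set of strings), decide whether $S$ can be partitioned into consecutive substrings each of which belongs to $D$. Here $n$ denotes the length of $S$ and $m$ the total length of all strings in $D$. An NFA is a tuple $M=(Q,\Sigma,\delta,q_0,F)$ with $\delta\subseteq Q\times\Sigma\times Q$ (no $\epsilon$-transitions); $M$ accepts $x\in\Sigma^*$ if there are states $q_1,\dots,q_{|x|}$ with $(q_i,x_{i+1},q_{i+1})\in\delta$ for all $0\le i<|x|$ and $q_{|x|}\in F$. NFA Acceptance: given $M$ and $x$, decide acceptance. The NFA Acceptance hypothesis states: for all $\alpha\in[1,2]$ and all $\beta,\varepsilon>0$, there is no (randomized) algorithm solving NFA Acceptance on NFAs with $n$ states, $m=\Theta(n^\alpha)$ transitions, alphabet size $n^{o(1)}$ and strings of length $\ell=\Theta(n^\beta)$ in time $O((m\ell)^{1-\varepsilon})$. *)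

theory Defs
  imports "HOL-Probability.Probability_Mass_Function"
begin

section \<open>Randomized word RAM\<close>

text \<open>
  The machine has registers, a zero-initialized random access memory, unit-cost arithmetic and
  bitwise operations, and a unit-cost source of uniformly random numbers.  Cells hold natural
  numbers; the word length of \<open>O(log N)\<close> bits is imposed in \<open>decides\<close> below, by demanding that an
  algorithm never produces a number exceeding a fixed power of the input size.
\<close>

datatype binop = Add | Sub | Mul | Div | Mod | BitAnd | BitOr | BitXor | ShiftL | ShiftR

primrec binop_val :: "binop \<Rightarrow> nat \<Rightarrow> nat \<Rightarrow> nat" where
  "binop_val Add a b = a + b"
| "binop_val Sub a b = a - b"
| "binop_val Mul a b = a * b"
| "binop_val Div a b = a div b"
| "binop_val Mod a b = a mod b"
| "binop_val BitAnd a b = and a b"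
| "binop_val BitOr a b = or a b"
| "binop_val BitXor a b = xor a b"
| "binop_val ShiftL a b = push_bit b a"
| "binop_val ShiftR a b = drop_bit b a"

datatype instr =
    LoadConst nat nat
  | Arith binop nat nat nat
  | Load nat nat
  | Store nat nat
  | Random nat nat
  | Jump nat
  | JumpLe nat nat nat

type_synonym program = "instr list"

record config =
  pc :: nat
  regs :: "nat \<Rightarrow> nat"
  mem :: "nat \<Rightarrow> nat"

definition write_reg :: "nat \<Rightarrow> nat \<Rightarrow> config \<Rightarrow> config" where
  "write_reg i v s = s\<lparr>pc := Suc (pc s), regs := (regs s)(i := v)\<rparr>"

primrec exec :: "instr \<Rightarrow> config \<Rightarrow> config pmf" where
  "exec (LoadConst i v) s = return_pmf (write_reg i v s)"
| "exec (Arith f i j k) s = return_pmf (write_reg i (binop_val f (regs s j) (regs s k)) s)"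
| "exec (Load i j) s = return_pmf (write_reg i (mem s (regs s j)) s)"
| "exec (Store i j) s =
     return_pmf (s\<lparr>pc := Suc (pc s), mem := (mem s)(regs s i := regs s j)\<rparr>)"
| "exec (Random i j) s = map_pmf (\<lambda>v. write_reg i v s) (pmf_of_set {..regs s j})"
| "exec (Jump l) s = return_pmf (s\<lparr>pc := l\<rparr>)"
| "exec (JumpLe i j l) s =
     return_pmf (s\<lparr>pc := (if regs s i \<le> regs s j then l else Suc (pc s))\<rparr>)"

definition halted :: "program \<Rightarrow> config \<Rightarrow> bool" where
  "halted P s \<longleftrightarrow> length P \<le> pc s"

definition step :: "program \<Rightarrow> config \<Rightarrow> config pmf" where
  "step P s = (if halted P s then return_pmf s else exec (P ! pc s) s)"

primrec run :: "program \<Rightarrow> nat \<Rightarrow> config \<Rightarrow> config pmf" where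
  "run P 0 s = return_pmf s"
| "run P (Suc t) s = bind_pmf (step P s) (run P t)"

definition init :: "nat list \<Rightarrow> config" where
  "init xs = \<lparr>pc = 0, regs = (\<lambda>_. 0), mem = (\<lambda>a. if a < length xs then xs ! a else 0)\<rparr>"

text \<open>The machine answers ``yes'' by halting with a nonzero value in register 0.\<close>

definition accepting :: "config \<Rightarrow> bool" where
  "accepting s \<longleftrightarrow> regs s 0 \<noteq> 0"

definition input_size :: "nat list \<Rightarrow> nat" where
  "input_size xs = 2 + length xs + Max (set (0 # xs))"

text \<open>
  Bounded-error (Monte Carlo) decision within \<open>T\<close> steps in the worst case, on words of
  \<open>k \<cdot> log\<^sub>2 (input_size xs)\<close> bits.
\<close>

definition decides :: "program \<Rightarrow> nat \<Rightarrow> nat list \<Rightarrow> bool \<Rightarrow> nat \<Rightarrow> bool" where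
  "decides P k xs answer T \<longleftrightarrow>
     (\<forall>t. \<forall>s \<in> set_pmf (run P t (init xs)).
        (\<forall>i. regs s i \<le> input_size xs ^ k) \<and> (\<forall>a. mem s a \<le> input_size xs ^ k)) \<and>
     (\<forall>s \<in> set_pmf (run P T (init xs)). halted P s) \<and>
     measure_pmf.prob (run P T (init xs)) {s. accepting s = answer} \<ge> 2 / 3"

text \<open>
  \<open>solvable_in_time I enc yes f\<close>: some randomized algorithm decides, in time \<open>O(f)\<close>, whether
  \<open>yes x\<close> holds for the instances \<open>x \<in> I\<close>; \<open>enc x xs\<close> means that \<open>xs\<close> is an encoding of \<open>x\<close> as a
  sequence of words.  The summand 1 only matters for instances with \<open>f x < 1\<close>, where a bound of
  \<open>C * f x\<close> alone could be unattainable for trivial reasons (for instance \<open>f x = 0\<close>).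
\<close>

definition solvable_in_time ::
  "'i set \<Rightarrow> ('i \<Rightarrow> nat list \<Rightarrow> bool) \<Rightarrow> ('i \<Rightarrow> bool) \<Rightarrow> ('i \<Rightarrow> real) \<Rightarrow> bool" where
  "solvable_in_time I enc yes f \<longleftrightarrow>
     (\<exists>P k C. \<forall>x \<in> I. \<forall>xs. enc x xs \<longrightarrow>
        (\<exists>T. real T \<le> C * (1 + f x) \<and> decides P k xs (yes x) T))"

text \<open>\<open>theta_bounded c a b\<close>: \<open>a = \<Theta>(b)\<close> with the hidden constants \<open>1/c\<close> and \<open>c\<close>.\<close>

definition theta_bounded :: "real \<Rightarrow> real \<Rightarrow> real \<Rightarrow> bool" where
  "theta_bounded c a b \<longleftrightarrow> b / c \<le> a \<and> a \<le> c * b"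


section \<open>NFA Acceptance\<close>

record ('q, 'a) nfa =
  states :: "'q set"
  alphabet :: "'a set"
  trans :: "('q \<times> 'a \<times> 'q) set"
  start :: 'q
  final :: "'q set"

definition wf_nfa :: "('q, 'a) nfa \<Rightarrow> bool" where
  "wf_nfa M \<longleftrightarrow> finite (states M) \<and> finite (alphabet M) \<and>
     trans M \<subseteq> states M \<times> alphabet M \<times> states M \<and>
     start M \<in> states M \<and> final M \<subseteq> states M"

definition nfa_accepts :: "('q, 'a) nfa \<Rightarrow> 'a list \<Rightarrow> bool" where
  "nfa_accepts M x \<longleftrightarrow>
     (\<exists>q :: nat \<Rightarrow> 'q. q 0 = start M \<and>
        (\<forall>i < length x. (q i, x ! i, q (Suc i)) \<in> trans M) \<and> q (length x) \<in> final M)"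

text \<open>As machine inputs, states and letters are named by initial segments of the naturals.\<close>

type_synonym nfa_instance = "(nat, nat) nfa \<times> nat list"

definition nfa_instances :: "nfa_instance set" where
  "nfa_instances = {(M, x). wf_nfa M \<and> states M = {..<card (states M)} \<and>
     alphabet M = {..<card (alphabet M)} \<and> set x \<subseteq> alphabet M}"

text \<open>Transitions and final states are listed in arbitrary order, without repetition.\<close>

definition nfa_encoding :: "nfa_instance \<Rightarrow> nat list \<Rightarrow> bool" where
  "nfa_encoding = (\<lambda>(M, x) xs. \<exists>ts fs.
     distinct ts \<and> set ts = trans M \<and> distinct fs \<and> set fs = final M \<and>
     xs = [card (states M), card (alphabet M), start M, length fs, length ts, length x]
          @ fs @ concat (map (\<lambda>(p, a, q). [p, a, q]) ts) @ x)"

text \<open>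
  Instances with \<open>\<Theta>(n\<^sup>\<alpha>)\<close> transitions, strings of length \<open>\<Theta>(n\<^sup>\<beta>)\<close>, and alphabet size at most
  \<open>n\<close> to the power \<open>g n\<close>, where \<open>n\<close> is the number of states.
\<close>

definition nfa_instances_restricted ::
  "real \<Rightarrow> real \<Rightarrow> real \<Rightarrow> (nat \<Rightarrow> real) \<Rightarrow> nfa_instance set" where
  "nfa_instances_restricted \<alpha> \<beta> c g = {(M, x) \<in> nfa_instances.
     let n = card (states M) in
       theta_bounded c (real (card (trans M))) (real n powr \<alpha>) \<and>
       theta_bounded c (real (length x)) (real n powr \<beta>) \<and>
       real (card (alphabet M)) \<le> real n powr g n}"

text \<open>
  A lower bound on instances with parameters \<open>\<Theta>(\<dots>)\<close> and alphabet size \<open>n\<^bsup>o(1)\<^esup>\<close> asserts hardness for some choice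
  of the hidden constants and of the \<open>o(1)\<close> function (for a bad choice there may be no instances
  at all).
\<close>

definition NFA_acceptance_hypothesis :: bool where
  "NFA_acceptance_hypothesis \<longleftrightarrow>
     (\<forall>\<alpha> \<beta> \<epsilon>. 1 \<le> \<alpha> \<and> \<alpha> \<le> 2 \<and> \<beta> > 0 \<and> \<epsilon> > 0 \<longrightarrow>
        (\<exists>c > 0. \<exists>g :: nat \<Rightarrow> real. g \<longlonglongrightarrow> 0 \<and>
           \<not> solvable_in_time (nfa_instances_restricted \<alpha> \<beta> c g) nfa_encoding
               (\<lambda>(M, x). nfa_accepts M x)
               (\<lambda>(M, x). (real (card (trans M)) * real (length x)) powr (1 - \<epsilon>))))"


section \<open>Word Break\<close>

definition word_breakable :: "'a list set \<Rightarrow> 'a list \<Rightarrow> bool" where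
  "word_breakable D S \<longleftrightarrow> (\<exists>ws. set ws \<subseteq> D \<and> concat ws = S)"

definition total_length :: "'a list set \<Rightarrow> nat" where
  "total_length D = (\<Sum>w \<in> D. length w)"

type_synonym wb_instance = "nat list \<times> nat list set"

text \<open>
  At most \<open>n + m\<close> different letters occur in an instance, so they can be named by numbers below
  \<open>n + m\<close>.
\<close>

definition wb_instances :: "wb_instance set" where
  "wb_instances = {(S, D). finite D \<and>
     (\<forall>w \<in> insert S D. \<forall>a \<in> set w. a < length S + total_length D)}"

text \<open>The words of the dictionary are listed in arbitrary order, each preceded by its length.\<close>

definition wb_encoding :: "wb_instance \<Rightarrow> nat list \<Rightarrow> bool" where
  "wb_encoding = (\<lambda>(S, D) xs. \<exists>ws. distinct ws \<and> set ws = D \<and>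
     xs = [length S, length ws] @ S @ concat (map (\<lambda>w. length w # w) ws))"

definition wb_instances_restricted :: "real \<Rightarrow> real \<Rightarrow> wb_instance set" where
  "wb_instances_restricted \<gamma> c = {(S, D) \<in> wb_instances.
     theta_bounded c (real (total_length D)) (real (length S) powr \<gamma>)}"

text \<open>Solvability on a set of Word Break instances in time \<open>O(n m\<^bsup>1/3-\<epsilon>\<^esup> + m)\<close>.\<close>

definition wb_solvable_fast :: "wb_instance set \<Rightarrow> real \<Rightarrow> bool" where
  "wb_solvable_fast I \<epsilon> \<longleftrightarrow>
     solvable_in_time I wb_encoding (\<lambda>(S, D). word_breakable D S)
       (\<lambda>(S, D). real (length S) * real (total_length D) powr (1 / 3 - \<epsilon>)
                  + real (total_length D))"

end

theory Submission
  imports Defs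
begin

text \<open>
  An NFA with \<open>n\<close> states, \<open>\<Theta>(n\<^sup>2)\<close> transitions and an input \<open>x\<close> is turned into a Word Break instance
  over the letters \<open>0, \<dots>, n - 1\<close> and \<open>n + a\<close> for the letters \<open>a\<close> of the NFA.  With \<open>R = n + |\<Sigma>|\<close>, the text is
  \<open>s \<dots> (n-1)\<close> followed by one block \<open>(n+a)\<^sup>R 0 1 \<dots> (n-1)\<close> for each letter \<open>a\<close> of \<open>x\<close>, where \<open>s\<close> is the
  start state.  A transition \<open>(p, a, q)\<close> gives the word \<open>p \<dots> (n-1) (n+a)\<^sup>R 0 \<dots> (q-1)\<close>, and a final state
  \<open>f\<close> gives the word \<open>f \<dots> (n-1)\<close>, so that a break right before the letter \<open>q\<close> of a block stands for
  being in state \<open>q\<close>.  The text has length \<open>\<Theta>(n |x|)\<close>; the padding by \<open>R\<close> copies makes the dictionary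
  have size \<open>\<Theta>(n\<^sup>3)\<close>, also when all words would otherwise be short, and bounds the letters by the
  length of the text.

  With \<open>|x| = \<Theta>(n\<^sup>\<beta>)\<close> and \<open>\<beta> = 3 / \<gamma> - 1 > 1\<close>, the dictionary size is \<open>\<Theta>\<close> of the \<open>\<gamma>\<close>-th power of the text
  length, and a Word Break algorithm as excluded by the theorem would decide acceptance in time
  \<open>O(n\<^bsup>2+\<beta>-3\<epsilon>\<^esup> + n\<^sup>3)\<close>, which is polynomially smaller than \<open>n\<^bsup>2+\<beta>\<^esup>\<close>.
\<close>


section \<open>Deterministic runs\<close>

lemma run_add: "run P (t + u) s = bind_pmf (run P t s) (run P u)"
proof (induction t arbitrary: s)
  case (Suc t)
  then have "run P (t + u) = (\<lambda>s. bind_pmf (run P t s) (run P u))" by auto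
  then show ?case by (simp add: bind_assoc_pmf)
qed (simp add: bind_return_pmf)

lemma run_halted: "halted P s \<Longrightarrow> run P t s = return_pmf s"
  by (induction t) (simp_all add: step_def bind_return_pmf)

lemma run_Suc_last: "run P (Suc t) s = bind_pmf (run P t s) (step P)"
proof -
  have 0: "run P 0 = return_pmf" by auto
  have "run P 1 s = step P s" for s
    by (simp add: 0 bind_return_pmf')
  then have "run P 1 = step P" ..
  then show ?thesis
    using run_add[of P t 1 s] by simp
qed

text \<open>The bound on the program counter, imposed before the last step only, keeps the run
  inside the first \<open>U\<close> instructions. This lets \<open>run_safe\<close> bound all
  intermediate values by a syntactic check of those instructions.\<close>

definition reaches :: "program \<Rightarrow> nat \<Rightarrow> nat \<Rightarrow> config \<Rightarrow> config \<Rightarrow> bool" where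
  "reaches P U t s s' \<longleftrightarrow> run P t s = return_pmf s' \<and>
     (\<forall>t' < t. \<forall>s'' \<in> set_pmf (run P t' s). pc s'' < U)"

lemma reaches_mono: "reaches P U t s s' \<Longrightarrow> U \<le> U' \<Longrightarrow> reaches P U' t s s'"
  unfolding reaches_def by fastforce

lemma reaches_trans:
  assumes "reaches P U t s s1" "reaches P U u s1 s2"
  shows "reaches P U (t + u) s s2"
  unfolding reaches_def
proof (intro conjI allI impI ballI)
  show "run P (t + u) s = return_pmf s2"
    using assms by (simp add: reaches_def run_add bind_return_pmf)
  fix t' s'' assume *: "t' < t + u" "s'' \<in> set_pmf (run P t' s)"
  show "pc s'' < U"
  proof (cases "t' < t")
    case True
    then show ?thesis using * assms by (auto simp: reaches_def)
  next
    case False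
    then obtain v where v: "t' = t + v" by (metis le_Suc_ex not_less)
    then have "s'' \<in> set_pmf (run P v s1)"
      using *(2) assms(1) by (simp add: reaches_def run_add bind_return_pmf)
    then show ?thesis using assms(2) v * by (auto simp: reaches_def)
  qed
qed

lemma reaches_step:
  assumes "pc s < U" "pc s < length P" "exec (P ! pc s) s = return_pmf s'"
  shows "reaches P U 1 s s'"
  using assms by (simp add: reaches_def step_def halted_def bind_return_pmf)


section \<open>Structured programs\<close>

lemma length_concat_map_const: "(\<And>y. length (f y) = c) \<Longrightarrow> length (concat (map f ys)) = c * length ys"
  by (induction ys) simp_all

lemma nth_concat_map_const:
  assumes "\<And>y. length (f y) = c" "k < length ys" "j < c"
  shows "concat (map f ys) ! (c * k + j) = f (ys ! k) ! j"
  using assms(2)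
proof (induction ys arbitrary: k)
  case (Cons y ys)
  then show ?case using assms(1,3) by (cases k) (simp_all add: nth_append)
qed simp


datatype com = Do instr | Seq com com (infixr ";;" 60) | While nat nat com

primrec clen :: "com \<Rightarrow> nat" where
  "clen (Do x) = 1"
| "clen (c ;; d) = clen c + clen d"
| "clen (While i j c) = clen c + 2"

text \<open>Jump targets are absolute, hence the load address \<open>l\<close>. A loop runs while
  register \<open>i\<close> is below register \<open>j\<close>, so its exit test is
  \<open>JumpLe\<close> with the operands swapped.\<close>

primrec compile :: "nat \<Rightarrow> com \<Rightarrow> program" where
  "compile l (Do x) = [x]"
| "compile l (c ;; d) = compile l c @ compile (l + clen c) d"
| "compile l (While i j c) = JumpLe j i (l + clen c + 2) # compile (Suc l) c @ [Jump l]"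

lemma length_compile [simp]: "length (compile l c) = clen c"
  by (induction c arbitrary: l) simp_all

abbreviation cfg :: "nat \<Rightarrow> (nat \<Rightarrow> nat) \<Rightarrow> (nat \<Rightarrow> nat) \<Rightarrow> config" where
  "cfg l r m \<equiv> \<lparr>pc = l, regs = r, mem = m\<rparr>"

type_synonym assertion = "(nat \<Rightarrow> nat) \<Rightarrow> (nat \<Rightarrow> nat) \<Rightarrow> nat \<Rightarrow> bool"

text \<open>Total correctness; the third argument of an assertion is the number of elapsed steps.\<close>

definition wp :: "com \<Rightarrow> assertion \<Rightarrow> assertion" where
  "wp c Q r m \<tau> \<longleftrightarrow> (\<forall>P u v. P = u @ compile (length u) c @ v \<longrightarrow>
     (\<exists>t r' m'. reaches P (length u + clen c) t (cfg (length u) r m)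
          (cfg (length u + clen c) r' m') \<and> Q r' m' (\<tau> + t)))"

lemma wp_conseq:
  assumes "wp c Q r m \<tau>" "\<And>r m \<tau>. Q r m \<tau> \<Longrightarrow> Q' r m \<tau>"
  shows "wp c Q' r m \<tau>"
  unfolding wp_def
proof (intro allI impI)
  fix P u v assume "P = u @ compile (length u) c @ v"
  from assms(1)[unfolded wp_def, rule_format, OF this] assms(2)
  show "\<exists>t r' m'. reaches P (length u + clen c) t (cfg (length u) r m)
      (cfg (length u + clen c) r' m') \<and> Q' r' m' (\<tau> + t)" by blast
qed

lemma wp_seq:
  assumes "wp c (\<lambda>r m \<tau>. wp d Q r m \<tau>) r m \<tau>"
  shows "wp (c ;; d) Q r m \<tau>"
  unfolding wp_def
proof (intro allI impI)
  fix P u v assume P: "P = u @ compile (length u) (c ;; d) @ v"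
  then have "P = u @ compile (length u) c @ (compile (length u + clen c) d @ v)" by simp
  then obtain t r1 m1 where 1: "reaches P (length u + clen c) t (cfg (length u) r m)
      (cfg (length u + clen c) r1 m1)" "wp d Q r1 m1 (\<tau> + t)"
    using assms unfolding wp_def by blast
  have "P = (u @ compile (length u) c) @ compile (length (u @ compile (length u) c)) d @ v"
    using P by simp
  then obtain t' r2 m2 where 2: "reaches P (length u + clen c + clen d) t'
      (cfg (length u + clen c) r1 m1) (cfg (length u + clen c + clen d) r2 m2)"
      "Q r2 m2 (\<tau> + t + t')"
    using 1(2)[unfolded wp_def, rule_format, of P "u @ compile (length u) c" v] by auto
  have "reaches P (length u + clen (c ;; d)) (t + t') (cfg (length u) r m)
      (cfg (length u + clen (c ;; d)) r2 m2)"
    using reaches_trans[OF reaches_mono[OF 1(1)] 2(1)] by (simp add: add.assoc)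
  then show "\<exists>t r' m'. reaches P (length u + clen (c ;; d)) t (cfg (length u) r m)
      (cfg (length u + clen (c ;; d)) r' m') \<and> Q r' m' (\<tau> + t)"
    using 2(2) by (metis add.assoc)
qed

lemma wp_Do:
  assumes "\<And>l. exec x (cfg l r m) = return_pmf (cfg (Suc l) r' m')" "Q r' m' (Suc \<tau>)"
  shows "wp (Do x) Q r m \<tau>"
  unfolding wp_def
proof (intro allI impI)
  fix P u v assume "P = u @ compile (length u) (Do x) @ v"
  then have "reaches P (length u + clen (Do x)) 1 (cfg (length u) r m)
      (cfg (length u + clen (Do x)) r' m')"
    by (intro reaches_step) (simp_all add: assms(1))
  then show "\<exists>t r' m'. reaches P (length u + clen (Do x)) t (cfg (length u) r m)
      (cfg (length u + clen (Do x)) r' m') \<and> Q r' m' (\<tau> + t)"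
    using assms(2) by fastforce
qed

lemma wp_LoadConst: "Q (r(i := v)) m (Suc \<tau>) \<Longrightarrow> wp (Do (LoadConst i v)) Q r m \<tau>"
  by (rule wp_Do) (simp_all add: write_reg_def)

lemma wp_Arith:
  "Q (r(i := binop_val f (r j) (r k))) m (Suc \<tau>) \<Longrightarrow> wp (Do (Arith f i j k)) Q r m \<tau>"
  by (rule wp_Do) (simp_all add: write_reg_def)

lemma wp_Load: "Q (r(i := m (r j))) m (Suc \<tau>) \<Longrightarrow> wp (Do (Load i j)) Q r m \<tau>"
  by (rule wp_Do) (simp_all add: write_reg_def)

lemma wp_Store: "Q r (m(r i := r j)) (Suc \<tau>) \<Longrightarrow> wp (Do (Store i j)) Q r m \<tau>"
  by (rule wp_Do) simp_all

lemmas wp_do = wp_LoadConst wp_Arith wp_Load wp_Store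
lemmas wp_intros = wp_seq wp_do

text \<open>The number \<open>K\<close> of rounds is fixed in advance and indexes the invariant,
  which gives termination and running time together. The extra \<open>Suc\<close>s pay for the test,
  the jump back and the final failing test.\<close>

lemma wp_While:
  assumes "I (0 :: nat) r m \<tau>"
    and body: "\<And>k r m \<tau>. k < K \<Longrightarrow> I k r m \<tau> \<Longrightarrow>
      r i < r j \<and> wp c (\<lambda>r m \<tau>. I (Suc k) r m (Suc \<tau>)) r m (Suc \<tau>)"
    and exit: "\<And>r m \<tau>. I K r m \<tau> \<Longrightarrow> \<not> r i < r j \<and> Q r m (Suc \<tau>)"
  shows "wp (While i j c) Q r m \<tau>"
  unfolding wp_def
proof (intro allI impI)
  fix P u v assume P: "P = u @ compile (length u) (While i j c) @ v"
  let ?l = "length u" let ?e = "?l + clen (While i j c)"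
  have P': "P = (u @ [JumpLe j i ?e]) @ compile (length (u @ [JumpLe j i ?e])) c @ (Jump ?l # v)"
    using P by simp
  have jmp: "P ! ?l = JumpLe j i ?e" using P by simp
  have bwd: "P ! (?l + Suc (clen c)) = Jump ?l"
    unfolding P by (simp add: nth_append)
  have len: "?e \<le> length P" using P by simp
  have "\<exists>t r' m'. reaches P ?e t (cfg ?l r m) (cfg ?e r' m') \<and> Q r' m' (\<tau> + t)"
    if "k \<le> K" "I k r m \<tau>" for k r m \<tau>
    using that
  proof (induction "K - k" arbitrary: k r m \<tau>)
    case 0
    then have "\<not> r i < r j \<and> Q r m (Suc \<tau>)" using exit by simp
    moreover from this have "reaches P ?e 1 (cfg ?l r m) (cfg ?e r m)"
      using len by (intro reaches_step) (simp_all add: jmp)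
    ultimately show ?case by fastforce
  next
    case (Suc d)
    then have k: "k < K" by simp
    then have lt: "r i < r j" and b: "wp c (\<lambda>r m \<tau>. I (Suc k) r m (Suc \<tau>)) r m (Suc \<tau>)"
      using body Suc.prems(2) by blast+
    have 1: "reaches P ?e 1 (cfg ?l r m) (cfg (Suc ?l) r m)"
      using len lt by (intro reaches_step) (simp_all add: jmp)
    obtain t r1 m1 where t: "reaches P (Suc ?l + clen c) t (cfg (Suc ?l) r m)
        (cfg (Suc ?l + clen c) r1 m1)" and I1: "I (Suc k) r1 m1 (Suc (Suc \<tau> + t))"
      using b[unfolded wp_def, rule_format, OF P'] by auto
    have 2: "reaches P ?e t (cfg (Suc ?l) r m) (cfg (Suc ?l + clen c) r1 m1)"
      by (rule reaches_mono[OF t]) simp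
    have 3: "reaches P ?e 1 (cfg (Suc ?l + clen c) r1 m1) (cfg ?l r1 m1)"
      using len bwd by (intro reaches_step) simp_all
    have "d = K - Suc k" "Suc k \<le> K" using Suc.hyps(2) k by linarith+
    then obtain t' r2 m2 where 4: "reaches P ?e t' (cfg ?l r1 m1) (cfg ?e r2 m2)"
        and Q: "Q r2 m2 (Suc (Suc \<tau> + t) + t')"
      using Suc.hyps(1)[OF _ _ I1] Suc.hyps(2) k by auto
    have "reaches P ?e (1 + (t + (1 + t'))) (cfg ?l r m) (cfg ?e r2 m2)"
      by (intro reaches_trans[OF 1] reaches_trans[OF 2] reaches_trans[OF 3] 4)
    moreover have "Q r2 m2 (\<tau> + (1 + (t + (1 + t'))))" using Q by (simp add: add.assoc)
    ultimately show ?case by blast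
  qed
  from this[of 0] assms(1)
  show "\<exists>t r' m'. reaches P ?e t (cfg ?l r m) (cfg ?e r' m') \<and> Q r' m' (\<tau> + t)" by simp
qed


section \<open>Growth of the values\<close>

definition val_bound :: "nat \<Rightarrow> config \<Rightarrow> bool" where
  "val_bound B s \<longleftrightarrow> (\<forall>i. regs s i \<le> B) \<and> (\<forall>a. mem s a \<le> B)"

abbreviation "ONE \<equiv> 5 :: nat"

text \<open>
  Safe instructions leave the even registers alone, and increase the largest value by at most 1
  provided that register \<open>ONE\<close> holds at most 1.
\<close>

primrec safe :: "instr \<Rightarrow> bool" where
  "safe (LoadConst i v) \<longleftrightarrow> odd i \<and> v \<le> 6 \<and> (i = ONE \<longrightarrow> v = 1)"
| "safe (Arith f i j k) \<longleftrightarrow> odd i \<and> i \<noteq> ONE \<and> (f = Sub \<or> f = Add \<and> k = ONE)"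
| "safe (Load i j) \<longleftrightarrow> odd i \<and> i \<noteq> ONE"
| "safe (Store i j) \<longleftrightarrow> True"
| "safe (Random i j) \<longleftrightarrow> False"
| "safe (Jump l) \<longleftrightarrow> True"
| "safe (JumpLe i j l) \<longleftrightarrow> True"

primrec safe_com :: "com \<Rightarrow> bool" where
  "safe_com (Do x) \<longleftrightarrow> safe x"
| "safe_com (c ;; d) \<longleftrightarrow> safe_com c \<and> safe_com d"
| "safe_com (While i j c) \<longleftrightarrow> safe_com c"

lemma safe_compile: "safe_com c \<Longrightarrow> x \<in> set (compile l c) \<Longrightarrow> safe x"
  by (induction c arbitrary: l) auto

text \<open>The even registers have to stay zero because they become the registers of the embedded
  program, which must find them in their initial state.\<close>

definition tame :: "nat \<Rightarrow> config \<Rightarrow> bool" where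
  "tame B s \<longleftrightarrow> val_bound B s \<and> (\<forall>i. even i \<longrightarrow> regs s i = 0) \<and> regs s ONE \<le> 1"

lemma exec_safe:
  assumes "safe x" "tame B s" "6 \<le> B" "s' \<in> set_pmf (exec x s)"
  shows "tame (Suc B) s'"
proof -
  have *: "regs s i \<le> Suc B" "mem s a \<le> Suc B" "regs s i - j \<le> Suc B"
      "regs s i + regs s ONE \<le> Suc B" for i a j
    using assms(2) unfolding tame_def val_bound_def
    by (auto intro: le_SucI diff_le_self order_trans[OF diff_le_self]
        simp: add_le_mono[of _ B _ 1, simplified])
  show ?thesis
    using assms
    by (cases x) (auto simp: tame_def val_bound_def write_reg_def *)
qed

text \<open>Each safe step raises the maximum by at most one, so a bound on the running time is at
  the same time a bound on the word length. The start value 6 covers the constants that safe code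
  may load.\<close>

lemma run_safe:
  assumes "\<forall>t' < t. \<forall>s \<in> set_pmf (run P t' s0). pc s < U"
    and "U \<le> length P" "\<forall>l < U. safe (P ! l)" "tame B s0" "6 \<le> B"
    and "s \<in> set_pmf (run P t s0)"
  shows "tame (B + t) s"
  using assms(1,6)
proof (induction t arbitrary: s)
  case 0
  then show ?case using assms(4) by simp
next
  case (Suc t)
  then obtain s1 where s1: "s1 \<in> set_pmf (run P t s0)" "s \<in> set_pmf (step P s1)"
    unfolding run_Suc_last set_bind_pmf by blast
  have "\<forall>t'<t. \<forall>s\<in>set_pmf (run P t' s0). pc s < U"
    using Suc.prems(1) by (simp add: less_Suc_eq)
  then have "tame (B + t) s1" "pc s1 < U"
    using Suc.IH Suc.prems(1) s1(1) by blast+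
  moreover have "s \<in> set_pmf (exec (P ! pc s1) s1)"
    using s1(2) assms(2) \<open>pc s1 < U\<close> by (auto simp: step_def halted_def)
  ultimately show ?case
    using exec_safe[of "P ! pc s1" "B + t" s1 s] assms(3,5) by simp
qed


section \<open>Embedding a program behind a preprocessing phase\<close>

abbreviation "BASE \<equiv> 19 :: nat"
abbreviation "ADDR \<equiv> 41 :: nat"

text \<open>
  The embedded program works on the even registers and on the memory from address \<open>BASE\<close> on.  Each
  instruction becomes two, so that jump targets are computed without inspecting the program.
\<close>

primrec embed_instr :: "nat \<Rightarrow> instr \<Rightarrow> program" where
  "embed_instr l (LoadConst i v) = [LoadConst ADDR 0, LoadConst (2 * i) v]"
| "embed_instr l (Arith f i j k) = [LoadConst ADDR 0, Arith f (2 * i) (2 * j) (2 * k)]"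
| "embed_instr l (Load i j) = [Arith Add ADDR (2 * j) BASE, Load (2 * i) ADDR]"
| "embed_instr l (Store i j) = [Arith Add ADDR (2 * i) BASE, Store ADDR (2 * j)]"
| "embed_instr l (Random i j) = [LoadConst ADDR 0, Random (2 * i) (2 * j)]"
| "embed_instr l (Jump l') = [LoadConst ADDR 0, Jump (l + 2 * l')]"
| "embed_instr l (JumpLe i j l') = [LoadConst ADDR 0, JumpLe (2 * i) (2 * j) (l + 2 * l')]"

definition embed :: "nat \<Rightarrow> program \<Rightarrow> program" where
  "embed l P = concat (map (embed_instr l) P)"

lemma length_embed_instr [simp]: "length (embed_instr l x) = 2"
  by (cases x) simp_all

lemma length_embed [simp]: "length (embed l P) = 2 * length P"
  by (simp add: embed_def length_concat_map_const)

lemma embed_nth: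
  "i < length P \<Longrightarrow> j < 2 \<Longrightarrow> embed l P ! (2 * i + j) = embed_instr l (P ! i) ! j"
  by (simp add: embed_def nth_concat_map_const)

definition proj :: "nat \<Rightarrow> nat \<Rightarrow> config \<Rightarrow> config" where
  "proj b l s = \<lparr>pc = (pc s - l) div 2, regs = (\<lambda>i. regs s (2 * i)), mem = (\<lambda>a. mem s (a + b))\<rparr>"

text \<open>This holds between embedded instructions, at even offsets from \<open>l\<close>. The
  registers and cells hidden by \<open>proj\<close> still count for the word length, hence the bound
  \<open>W\<close> on them.\<close>

definition embed_inv :: "nat \<Rightarrow> nat \<Rightarrow> nat \<Rightarrow> config \<Rightarrow> bool" where
  "embed_inv W b l s \<longleftrightarrow> (\<exists>k. pc s = l + 2 * k) \<and> regs s BASE = b \<and>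
     (\<forall>i. odd i \<longrightarrow> regs s i \<le> W) \<and> (\<forall>a < b. mem s a \<le> W)"

lemma embed_inv_val_bound:
  assumes "embed_inv W b l s" "val_bound V (proj b l s)" "V \<le> W"
  shows "val_bound W s"
  unfolding val_bound_def
proof (intro conjI allI)
  fix i show "regs s i \<le> W"
  proof (cases "even i")
    case True
    then obtain j where "i = 2 * j" by blast
    then have "regs s i \<le> V" using assms(2) by (auto simp: val_bound_def proj_def)
    then show ?thesis using assms(3) by simp
  qed (use assms(1) in \<open>auto simp: embed_inv_def\<close>)
next
  fix a show "mem s a \<le> W"
  proof (cases "a < b")
    case False
    have "mem s (a - b + b) \<le> V" using assms(2) unfolding val_bound_def proj_def by simp
    then show ?thesis using False assms(3) by simp
  qed (use assms(1) in \<open>auto simp: embed_inv_def\<close>)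
qed

context
  fixes pre P Q :: program and b W V l :: nat
  assumes Q: "Q = pre @ embed l P" and l: "l = length pre" and bV: "b + V \<le> W"
begin

lemma halted_proj: "embed_inv W b l s \<Longrightarrow> halted Q s \<longleftrightarrow> halted P (proj b l s)"
  by (auto simp: Q l embed_inv_def halted_def proj_def)

text \<open>These are the possible states halfway through an embedded instruction. The one new value
  is 0 or an address shifted by \<open>b\<close>, and \<open>b + V \<le> W\<close> leaves room for
  the shift.\<close>

lemma proj_write:
  assumes "embed_inv W b l s" "regs s (2 * i) = v" "val_bound V (proj b l s)"
  shows "val_bound W (write_reg ADDR 0 s)" "val_bound W (write_reg ADDR (v + b) s)"
proof -
  have "v \<le> V" using assms(2,3) by (auto simp: val_bound_def proj_def)
  then show "val_bound W (write_reg ADDR 0 s)" "val_bound W (write_reg ADDR (v + b) s)"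
    using embed_inv_val_bound[OF assms(1,3)] bV by (auto simp: val_bound_def write_reg_def)
qed

lemma embed_step:
  assumes s: "embed_inv W b l s" "val_bound V (proj b l s)"
  shows "\<forall>s' \<in> set_pmf (run Q 1 s). val_bound W s'"
    and "\<forall>s' \<in> set_pmf (run Q 2 s). embed_inv W b l s'"
    and "map_pmf (proj b l) (run Q 2 s) = step P (proj b l s)"
proof -
  have *: "(\<forall>s' \<in> set_pmf (run Q 1 s). val_bound W s') \<and>
      (\<forall>s' \<in> set_pmf (run Q 2 s). embed_inv W b l s') \<and>
      map_pmf (proj b l) (run Q 2 s) = step P (proj b l s)"
  proof (cases "halted Q s")
    case True
    then have "halted P (proj b l s)" using halted_proj s(1) by simp
    then show ?thesis
      using True s embed_inv_val_bound[OF s] bV by (simp add: run_halted step_def)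
  next
    case False
    obtain k where k: "pc s = l + 2 * k" using s(1) by (auto simp: embed_inv_def)
    have kP: "k < length P" using False by (simp add: halted_def k Q l)
    have x0: "Q ! (l + 2 * k) = embed_instr l (P ! k) ! 0"
      and x1: "Q ! Suc (l + 2 * k) = embed_instr l (P ! k) ! 1"
      using embed_nth[OF kP, of 0 l] embed_nth[OF kP, of 1 l]
      by (simp_all add: Q l nth_append)
    have st: "step Q s = exec (embed_instr l (P ! k) ! 0) s"
      using False by (simp add: step_def k x0)
    have st1: "step Q s' = exec (embed_instr l (P ! k) ! 1) s'" if "pc s' = Suc (l + 2 * k)" for s'
      using kP by (simp add: step_def that x1[simplified] halted_def) (simp add: Q l)
    have run1: "run Q 1 s = exec (embed_instr l (P ! k) ! 0) s"
      using run_Suc_last[of Q 0 s] by (simp add: bind_return_pmf st)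
    have run2: "run Q 2 s = bind_pmf (exec (embed_instr l (P ! k) ! 0) s) (step Q)"
      using run_Suc_last[of Q 1 s] by (simp add: run1[simplified] numeral_2_eq_2)
    have pk: "pc (proj b l s) = k" by (simp add: proj_def k)
    have stP: "step P (cfg k (\<lambda>i. regs s (2 * i)) (\<lambda>a. mem s (a + b)))
        = exec (P ! k) (cfg k (\<lambda>i. regs s (2 * i)) (\<lambda>a. mem s (a + b)))"
      using kP by (simp add: step_def halted_def)
    have base: "regs s BASE = b"
      and bnd: "\<And>i. odd i \<Longrightarrow> regs s i \<le> W" "\<And>a. a < b \<Longrightarrow> mem s a \<le> W"
      using s(1) by (simp_all add: embed_inv_def)
    have sum: "regs s (2 * i) + b \<le> W" for i
    proof -
      have "regs s (2 * i) \<le> V" using s(2) by (simp add: val_bound_def proj_def)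
      then show ?thesis using bV by linarith
    qed
    \<comment> \<open>The embedded program writes even registers, which cannot collide with
      \<open>BASE\<close> and \<open>ADDR\<close>.\<close>
    have par: "2 * i \<noteq> BASE" "2 * i \<noteq> ADDR" "BASE \<noteq> 2 * i" "ADDR \<noteq> 2 * i" for i :: nat
      by presburger+
    have ex: "\<exists>k'. Suc (Suc (2 * k)) = 2 * k'" by presburger
    note vb = proj_write[OF s(1) refl s(2), unfolded write_reg_def k]
    show ?thesis
      by (cases "P ! k") (auto simp: run1 run2 st st1 bind_return_pmf k write_reg_def vb base bnd sum par ex
          stP proj_def embed_inv_def fun_eq_iff pmf.map_comp o_def intro!: pmf.map_cong)
  qed
  then show "\<forall>s' \<in> set_pmf (run Q 1 s). val_bound W s'"
    "\<forall>s' \<in> set_pmf (run Q 2 s). embed_inv W b l s'"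
    "map_pmf (proj b l) (run Q 2 s) = step P (proj b l s)" by auto
qed

text \<open>The value bound ranges over all times, so every successor state inherits it and the
  induction goes through. Equality of distributions, not just of supports, is what preserves the
  acceptance probability.\<close>

lemma embed_run:
  assumes "embed_inv W b l s" "\<forall>t. \<forall>s' \<in> set_pmf (run P t (proj b l s)). val_bound V s'"
  shows "map_pmf (proj b l) (run Q (2 * t) s) = run P t (proj b l s) \<and>
     (\<forall>s' \<in> set_pmf (run Q (2 * t) s). embed_inv W b l s')"
  using assms
proof (induction t arbitrary: s)
  case (Suc t)
  have "val_bound V (proj b l s)"
    using Suc.prems(2)[rule_format, of "proj b l s" 0] by simp
  note st = embed_step[OF Suc.prems(1) this]
  have run2: "run Q (2 * Suc t) s = bind_pmf (run Q 2 s) (run Q (2 * t))"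
    using run_add[of Q 2 "2 * t" s] by simp
  have IH: "map_pmf (proj b l) (run Q (2 * t) s') = run P t (proj b l s') \<and>
     (\<forall>s' \<in> set_pmf (run Q (2 * t) s'). embed_inv W b l s')"
    if s': "s' \<in> set_pmf (run Q 2 s)" for s'
  proof (rule Suc.IH)
    show "embed_inv W b l s'" using st(2) s' by blast
    have "proj b l s' \<in> set_pmf (step P (proj b l s))"
      using s' by (simp flip: st(3))
    then show "\<forall>t. \<forall>s' \<in> set_pmf (run P t (proj b l s')). val_bound V s'"
      using Suc.prems(2)[rule_format, of _ "Suc t" for t] by auto
  qed
  have "map_pmf (proj b l) (run Q (2 * Suc t) s)
      = bind_pmf (run Q 2 s) (\<lambda>s'. map_pmf (proj b l) (run Q (2 * t) s'))"
    unfolding run2 by (simp add: map_bind_pmf)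
  also have "\<dots> = bind_pmf (run Q 2 s) (\<lambda>s'. run P t (proj b l s'))"
    by (intro bind_pmf_cong) (use IH in auto)
  also have "\<dots> = bind_pmf (map_pmf (proj b l) (run Q 2 s)) (run P t)"
    by (simp add: bind_map_pmf)
  also have "\<dots> = run P (Suc t) (proj b l s)" by (simp add: st(3))
  finally show ?case using IH unfolding run2 by auto
qed simp

text \<open>\<open>decides\<close> bounds the values at every time. Even times are covered by the
  simulation; odd times lie halfway through an embedded instruction, where \<open>embed_step\<close>
  gives the bound.\<close>

lemma embed_run_val_bound:
  assumes "embed_inv W b l s" "\<forall>t. \<forall>s' \<in> set_pmf (run P t (proj b l s)). val_bound V s'"
    and "s' \<in> set_pmf (run Q t s)"
  shows "val_bound W s'"
proof -
  have even: "embed_inv W b l s1 \<and> val_bound V (proj b l s1)"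
    if "s1 \<in> set_pmf (run Q (2 * u) s)" for s1 u
  proof -
    note r = embed_run[OF assms(1,2), of u]
    have "proj b l s1 \<in> set_pmf (run P u (proj b l s))" using that r[THEN conjunct1, symmetric] by auto
    then show ?thesis using r that assms(2) by blast
  qed
  show ?thesis
  proof (cases "even t")
    case True
    then obtain u where "t = 2 * u" by blast
    then show ?thesis using even assms(3) embed_inv_val_bound bV by (meson le_add2 le_trans)
  next
    case False
    then obtain u where "t = Suc (2 * u)" by (elim oddE) simp
    then obtain s1 where "s1 \<in> set_pmf (run Q (2 * u) s)" "s' \<in> set_pmf (step Q s1)"
      using assms(3) unfolding run_Suc_last \<open>t = _\<close> set_bind_pmf by blast
    moreover have "run Q 1 s1 = step Q s1" using run_Suc_last[of Q 0 s1] by (simp add: bind_return_pmf)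
    ultimately show ?thesis using embed_step(1) even by metis
  qed
qed

end


section \<open>Preprocessing followed by the embedded program\<close>

definition write_list :: "(nat \<Rightarrow> nat) \<Rightarrow> nat \<Rightarrow> nat list \<Rightarrow> nat \<Rightarrow> nat" where
  "write_list m a xs = (\<lambda>i. if a \<le> i \<and> i < a + length xs then xs ! (i - a) else m i)"

text \<open>When the preprocessing ends, \<open>proj\<close> sees exactly \<open>init ys\<close>:
  the output lies right behind the input at the address in \<open>BASE\<close>, and the even
  registers are zero. From there the simulation takes two steps for each step of \<open>P\<close>.
  The power \<open>k'\<close> must cover the growth during preprocessing as well as the shifted
  addresses of \<open>P\<close>.\<close>

lemma decides_reduction:
  assumes wp: "wp c (\<lambda>r m \<tau>. r BASE = length xs \<and>
      m = write_list (mem (init xs)) (length xs) ys \<and> \<tau> \<le> T0) (\<lambda>_. 0) (mem (init xs)) 0"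
    and safe: "safe_com c"
    and P: "decides P k ys ans T"
    and size: "6 \<le> input_size xs" "input_size xs + T0 + input_size ys ^ k \<le> input_size xs ^ k'"
  shows "\<exists>T' \<le> T0 + 2 * T. decides (compile 0 c @ embed (clen c) P) k' xs ans T'"
proof -
  define Q where "Q = compile 0 c @ embed (clen c) P"
  define m0 where "m0 = mem (init xs)"
  define b where "b = length xs"
  define V where "V = input_size ys ^ k"
  define W where "W = input_size xs ^ k'"
  have init: "init zs = cfg 0 (\<lambda>_. 0) (mem (init zs))" for zs by (simp add: init_def)
  have "Q = [] @ compile (length []) c @ embed (clen c) P" by (simp add: Q_def)
  with wp[unfolded wp_def, rule_format, OF this]
  obtain t0 r' where t0: "reaches Q (clen c) t0 (init xs) (cfg (clen c) r' (write_list m0 b ys))"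
      "r' BASE = b" "t0 \<le> T0"
    by (auto simp: m0_def b_def simp flip: init)
  define s0 where "s0 = cfg (clen c) r' (write_list m0 b ys)"
  have run0: "run Q t0 (init xs) = return_pmf s0"
    and pc0: "\<forall>t' < t0. \<forall>s \<in> set_pmf (run Q t' (init xs)). pc s < clen c"
    using t0(1) by (auto simp: reaches_def s0_def)
  have bW: "b + V \<le> W"
    using size(2) by (simp add: b_def V_def W_def input_size_def)
  have "xs ! i \<le> Max (set (0 # xs))" if "i < length xs" for i
    using that by (intro Max_ge) auto
  then have tame0: "tame (input_size xs) (init xs)"
    unfolding tame_def val_bound_def init_def input_size_def
    by (auto simp del: Max_insert set_simps simp: trans_le_add2 le_SucI)
  have tame: "tame (input_size xs + t) s" if "t \<le> t0" "s \<in> set_pmf (run Q t (init xs))" for s t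
  proof (rule run_safe[OF _ _ _ tame0 size(1) that(2)])
    show "\<forall>t' < t. \<forall>s \<in> set_pmf (run Q t' (init xs)). pc s < clen c" using pc0 that(1) by (meson less_le_trans)
    show "clen c \<le> length Q" by (simp add: Q_def)
    show "\<forall>l < clen c. safe (Q ! l)"
      using safe_compile[OF safe, of _ 0] by (auto simp: Q_def nth_append)
  qed
  have early: "val_bound W s" if "t \<le> t0" "s \<in> set_pmf (run Q t (init xs))" for s t
  proof -
    have "val_bound (input_size xs + t) s" using tame[OF that] by (simp add: tame_def)
    moreover have "input_size xs + t \<le> W" using that(1) t0(3) size(2) by (simp add: W_def)
    ultimately show ?thesis unfolding val_bound_def by (meson le_trans)
  qed
  have s0: "tame (input_size xs + t0) s0" "val_bound W s0"
    using tame[of t0] early[of t0] by (simp_all add: run0)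
  have inv: "embed_inv W b (clen c) s0"
    unfolding embed_inv_def
  proof (intro conjI exI)
    show "pc s0 = clen c + 2 * 0" by (simp add: s0_def)
  qed (use s0(2) t0(2) in \<open>auto simp: s0_def val_bound_def\<close>)
  \<comment> \<open>Cells behind \<open>ys\<close> are also behind the input, so they still hold 0
    as in \<open>init ys\<close>.\<close>
  have "write_list m0 b ys (a + b) = mem (init ys) a" for a
    by (auto simp: write_list_def init_def m0_def b_def)
  moreover have "r' (2 * i) = 0" for i
    using s0(1) by (simp add: tame_def s0_def)
  ultimately have proj0: "proj b (clen c) s0 = init ys"
    by (subst init) (simp add: proj_def s0_def)
  have PV: "\<forall>t. \<forall>s' \<in> set_pmf (run P t (proj b (clen c) s0)). val_bound V s'"
    using P by (simp add: decides_def proj0 val_bound_def V_def)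
  note ctx = Q_def length_compile[symmetric] bW
  note run = embed_run[OF ctx inv PV]
  have runT: "run Q (t0 + 2 * T) (init xs) = run Q (2 * T) s0"
    by (simp add: run_add run0 bind_return_pmf)
  have "decides Q k' xs ans (t0 + 2 * T)"
    unfolding decides_def
  proof (intro conjI allI ballI)
    fix t s assume s: "s \<in> set_pmf (run Q t (init xs))"
    have "val_bound W s"
    proof (cases "t \<le> t0")
      case False
      then have "s \<in> set_pmf (run Q (t - t0) s0)"
        using s run_add[of Q t0 "t - t0" "init xs"] by (simp add: run0 bind_return_pmf)
      then show ?thesis using embed_run_val_bound[OF ctx inv PV] by blast
    qed (use early s in blast)
    then show "regs s i \<le> input_size xs ^ k'" "mem s a \<le> input_size xs ^ k'" for i a
      by (auto simp: val_bound_def W_def)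
  next
    fix s assume s: "s \<in> set_pmf (run Q (t0 + 2 * T) (init xs))"
    then have "proj b (clen c) s \<in> set_pmf (run P T (init ys))"
      using run[of T, THEN conjunct1, symmetric] by (simp add: runT proj0)
    then have "halted P (proj b (clen c) s)" using P by (simp add: decides_def)
    then show "halted Q s" using halted_proj[OF ctx] run[of T] s runT by auto
  next
    have "measure_pmf.prob (run P T (init ys)) {s. accepting s = ans}
        = measure_pmf.prob (run Q (2 * T) s0) (proj b (clen c) -` {s. accepting s = ans})"
      unfolding proj0[symmetric] run[of T, THEN conjunct1, symmetric] by simp
    \<comment> \<open>The answer register 0 is its own image under doubling.\<close>
    also have "proj b (clen c) -` {s. accepting s = ans} = {s. accepting s = ans}"
      by (auto simp: accepting_def proj_def)
    finally show "2 / 3 \<le> measure_pmf.prob (run Q (t0 + 2 * T) (init xs)) {s. accepting s = ans}"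
      using P by (simp add: decides_def runT)
  qed
  then show ?thesis using t0(3) unfolding Q_def by (intro exI[of _ "t0 + 2 * T"]) simp
qed


section \<open>The preprocessing phase\<close>

definition trans_word :: "nat \<Rightarrow> nat \<Rightarrow> nat \<times> nat \<times> nat \<Rightarrow> nat list" where
  "trans_word n r = (\<lambda>(p, a, q). [p..<n] @ replicate r (n + a) @ [0..<q])"

definition final_word :: "nat \<Rightarrow> nat \<Rightarrow> nat list" where
  "final_word n f = [f..<n]"

definition wb_text :: "nat \<Rightarrow> nat \<Rightarrow> nat \<Rightarrow> nat list \<Rightarrow> nat list" where
  "wb_text n r p x = [p..<n] @ concat (map (\<lambda>a. replicate r (n + a) @ [0..<n]) x)"

abbreviation delimited :: "nat list list \<Rightarrow> nat list" where
  "delimited ws \<equiv> concat (map (\<lambda>w. length w # w) ws)"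

lemma write_list_append:
  "write_list (write_list m a xs) (a + length xs) ys = write_list m a (xs @ ys)"
  by (auto simp: write_list_def fun_eq_iff nth_append)

lemma write_list_append':
  "c = a + length xs \<Longrightarrow> write_list (write_list m a xs) c ys = write_list m a (xs @ ys)"
  by (simp add: write_list_append)

text \<open>Lengths precede the lists they measure but are known only afterwards. Their cells are
  therefore skipped and filled in at the end.\<close>

lemma write_list_Cons: "(write_list m (Suc a) xs)(a := x) = write_list m a (x # xs)"
  by (auto simp: write_list_def fun_eq_iff nth_Cons Suc_diff_le split: nat.splits)
    (metis diff_Suc_Suc Suc_inject Suc_diff_Suc Suc_le_lessD diff_diff_left)

lemma write_list_single: "m(a := x) = write_list m a [x]"
  by (auto simp: write_list_def fun_eq_iff)

lemma write_list_less [simp]: "i < a \<Longrightarrow> write_list m a xs i = m i"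
  by (simp add: write_list_def)

lemma write_list_Nil [simp]: "write_list m a [] = m"
  by (auto simp: write_list_def fun_eq_iff)

text \<open>
  \<open>XP\<close>, \<open>TP\<close>, \<open>FP\<close> are the positions for reading the string, the transitions and the final states,
  the latter two lists ending before \<open>TE\<close> and \<open>FE\<close>.  \<open>OUT\<close> is the next cell to be written, and
  \<open>WST\<close> the cell reserved for the length of the current word.
\<close>

abbreviation "ZERO \<equiv> 3 :: nat"
abbreviation "NQ \<equiv> 7 :: nat"
abbreviation "SG \<equiv> 9 :: nat"
abbreviation "ST \<equiv> 11 :: nat"
abbreviation "NF \<equiv> 13 :: nat"
abbreviation "NT \<equiv> 15 :: nat"
abbreviation "LX \<equiv> 17 :: nat"
abbreviation "XP \<equiv> 21 :: nat"
abbreviation "TP \<equiv> 23 :: nat"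
abbreviation "FP \<equiv> 25 :: nat"
abbreviation "RR \<equiv> 27 :: nat"
abbreviation "OUT \<equiv> 29 :: nat"
abbreviation "LET \<equiv> 31 :: nat"
abbreviation "VAL \<equiv> 33 :: nat"
abbreviation "WST \<equiv> 35 :: nat"
abbreviation "TMP \<equiv> 37 :: nat"
abbreviation "QQ \<equiv> 39 :: nat"
abbreviation "TE \<equiv> 43 :: nat"
abbreviation "FE \<equiv> 45 :: nat"

section \<open>Building blocks of the preprocessing: copying, adding, writing ranges and
  padding\<close>

abbreviation "inc i \<equiv> Do (Arith Add i i ONE)"
text \<open>Subtracting \<open>ZERO\<close>, a register that is never written, serves as a copy,
  because \<open>safe\<close> allows every subtraction but only additions of
  \<open>ONE\<close>.\<close>

abbreviation "copy i j \<equiv> Do (Arith Sub i j ZERO)"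

text \<open>Addition is done by unit increments so that the code is \<open>safe\<close>. The cost is
  linear in the summand.\<close>

definition add_to :: "nat \<Rightarrow> nat \<Rightarrow> com" where
  "add_to i j = Do (LoadConst TMP 0) ;; While TMP j (inc i ;; inc TMP)"

definition emit_range :: "nat \<Rightarrow> com" where
  "emit_range j = While VAL j (Do (Store OUT VAL) ;; inc OUT ;; inc VAL)"

definition emit_letter :: com where
  "emit_letter = Do (LoadConst TMP 0) ;; While TMP RR (Do (Store OUT LET) ;; inc OUT ;; inc TMP)"

text \<open>A round takes four steps: the test, two increments and the jump back. The initialization
  and the failing test add two.\<close>

lemma wp_add:
  assumes "r ONE = 1" "i \<noteq> j" "i \<noteq> TMP" "j \<noteq> TMP" "i \<noteq> ONE"
    and "Q (r(i := r i + r j, TMP := r j)) m (\<tau> + 4 * r j + 2)"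
  shows "wp (add_to i j) Q r m \<tau>"
  unfolding add_to_def
proof (intro wp_intros)
  show "wp (While TMP j (inc i ;; inc TMP)) Q (r(TMP := 0)) m (Suc \<tau>)"
  proof (rule wp_While[where K = "r j" and
        I = "\<lambda>k r' m' \<tau>'. r' = r(i := r i + k, TMP := k) \<and> m' = m \<and> \<tau>' = Suc \<tau> + 4 * k"])
    fix k r' m' \<tau>'
    assume "k < r j" "r' = r(i := r i + k, TMP := k) \<and> m' = m \<and> \<tau>' = Suc \<tau> + 4 * k"
    then show "r' TMP < r' j \<and> wp (inc i ;; inc TMP) (\<lambda>r' m' \<tau>'. r' = r(i := r i + Suc k, TMP := Suc k)
        \<and> m' = m \<and> Suc \<tau>' = Suc \<tau> + 4 * Suc k) r' m' (Suc \<tau>')"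
      using assms(1-5) by (elim conjE, hypsubst, intro conjI wp_intros; simp add: fun_eq_iff)
  qed (use assms in auto)
qed

lemma wp_emit_range:
  assumes "r ONE = 1" "r VAL \<le> r j" "j \<notin> {VAL, OUT}"
    and "Q (r(OUT := r OUT + (r j - r VAL), VAL := r j)) (write_list m (r OUT) [r VAL..<r j])
           (\<tau> + 5 * (r j - r VAL) + 1)"
  shows "wp (emit_range j) Q r m \<tau>"
  unfolding emit_range_def
proof (rule wp_While[where K = "r j - r VAL" and
      I = "\<lambda>k r' m' \<tau>'. r' = r(OUT := r OUT + k, VAL := r VAL + k) \<and>
             m' = write_list m (r OUT) [r VAL..<r VAL + k] \<and> \<tau>' = \<tau> + 5 * k"])
  fix k r' m' \<tau>'
  assume k: "k < r j - r VAL" and I: "r' = r(OUT := r OUT + k, VAL := r VAL + k) \<and>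
      m' = write_list m (r OUT) [r VAL..<r VAL + k] \<and> \<tau>' = \<tau> + 5 * k"
  have "(write_list m (r OUT) [r VAL..<r VAL + k])(r OUT + k := r VAL + k)
      = write_list m (r OUT) [r VAL..<r VAL + Suc k]"
    using write_list_append[of m "r OUT" "[r VAL..<r VAL + k]" "[r VAL + k]"]
    by (simp add: write_list_single[of _ "r OUT + k"])
  then show "r' VAL < r' j \<and> wp (Do (Store OUT VAL) ;; inc OUT ;; inc VAL)
      (\<lambda>r' m' \<tau>'. r' = r(OUT := r OUT + Suc k, VAL := r VAL + Suc k) \<and>
         m' = write_list m (r OUT) [r VAL..<r VAL + Suc k] \<and> Suc \<tau>' = \<tau> + 5 * Suc k) r' m' (Suc \<tau>')"
    using assms(1-3) I k by (elim conjE, hypsubst, intro conjI wp_intros; simp add: fun_eq_iff del: upt_Suc)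
qed (use assms in auto)

lemma wp_emit_letter:
  assumes "r ONE = 1"
    and "Q (r(OUT := r OUT + r RR, TMP := r RR)) (write_list m (r OUT) (replicate (r RR) (r LET)))
           (\<tau> + 5 * r RR + 2)"
  shows "wp emit_letter Q r m \<tau>"
  unfolding emit_letter_def
proof (intro wp_intros)
  let ?I = "\<lambda>k r' m' \<tau>'. r' = r(OUT := r OUT + k, TMP := k) \<and>
      m' = write_list m (r OUT) (replicate k (r LET)) \<and> \<tau>' = Suc \<tau> + 5 * k"
  show "wp (While TMP RR (Do (Store OUT LET) ;; inc OUT ;; inc TMP)) Q (r(TMP := 0)) m (Suc \<tau>)"
  proof (rule wp_While[where K = "r RR" and I = ?I])
    fix k r' m' \<tau>'
    assume k: "k < r RR" and I: "?I k r' m' \<tau>'"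
    have "(write_list m (r OUT) (replicate k (r LET)))(r OUT + k := r LET)
        = write_list m (r OUT) (replicate (Suc k) (r LET))"
      using write_list_append[of m "r OUT" "replicate k (r LET)" "[r LET]"]
      by (simp add: write_list_single[of _ "r OUT + k"] replicate_append_same del: replicate_Suc)
        (simp add: replicate_append_same)
    then show "r' TMP < r' RR \<and> wp (Do (Store OUT LET) ;; inc OUT ;; inc TMP)
        (\<lambda>r' m' \<tau>'. ?I (Suc k) r' m' (Suc \<tau>')) r' m' (Suc \<tau>')"
      using assms(1) I k by (elim conjE, hypsubst, intro conjI wp_intros; simp add: fun_eq_iff del: replicate_Suc)
  qed (use assms in auto)
qed

lemmas wp_blocks = wp_add wp_emit_letter wp_emit_range

text \<open>The header fills the cells 0 to 5, so the final states start at 6. A transition occupies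
  three cells, hence the threefold addition of \<open>NT\<close>.\<close>

definition setup_code :: com where
  "setup_code =
     Do (LoadConst ONE 1) ;;
     Do (LoadConst TMP 0) ;; Do (Load NQ TMP) ;; Do (LoadConst TMP 1) ;; Do (Load SG TMP) ;;
     Do (LoadConst TMP 2) ;; Do (Load ST TMP) ;; Do (LoadConst TMP 3) ;; Do (Load NF TMP) ;;
     Do (LoadConst TMP 4) ;; Do (Load NT TMP) ;; Do (LoadConst TMP 5) ;; Do (Load LX TMP) ;;
     Do (LoadConst FP 6) ;; copy TP FP ;; add_to TP NF ;; copy FE TP ;;
     copy XP TP ;; add_to XP NT ;; add_to XP NT ;; add_to XP NT ;; copy TE XP ;;
     copy BASE XP ;; add_to BASE LX ;; copy RR NQ ;; add_to RR SG"

text \<open>The string is the last part of the input and the output starts right behind it, so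
  \<open>BASE\<close> also ends the loop over the string. Two header cells are discounted from
  \<open>OUT - BASE\<close> to get the text length.\<close>

definition text_code :: com where
  "text_code =
     copy LET NF ;; add_to LET NT ;; copy OUT BASE ;; inc OUT ;; Do (Store OUT LET) ;; inc OUT ;;
     copy VAL ST ;; emit_range NQ ;;
     While XP BASE
       (Do (Load LET XP) ;; add_to LET NQ ;; emit_letter ;; Do (LoadConst VAL 0) ;; emit_range NQ ;;
        inc XP) ;;
     Do (Arith Sub TMP OUT BASE) ;; Do (Arith Sub TMP TMP ONE) ;; Do (Arith Sub TMP TMP ONE) ;;
     Do (Store BASE TMP)"

definition end_word :: com where
  "end_word = Do (Arith Sub TMP OUT WST) ;; Do (Arith Sub TMP TMP ONE) ;; Do (Store WST TMP)"

definition trans_code :: com where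
  "trans_code =
     While TP TE
       (copy WST OUT ;; inc OUT ;; Do (Load VAL TP) ;; inc TP ;; Do (Load LET TP) ;; inc TP ;;
        Do (Load QQ TP) ;; inc TP ;; emit_range NQ ;; add_to LET NQ ;; emit_letter ;;
        Do (LoadConst VAL 0) ;; emit_range QQ ;; end_word)"

definition final_code :: com where
  "final_code =
     While FP FE
       (copy WST OUT ;; inc OUT ;; Do (Load VAL FP) ;; inc FP ;; emit_range NQ ;; end_word)"

definition prep :: com where
  "prep = setup_code ;; text_code ;; trans_code ;; final_code"

lemma safe_prep: "safe_com prep"
  by (simp add: prep_def setup_code_def text_code_def trans_code_def final_code_def end_word_def
      add_to_def emit_range_def emit_letter_def)

section \<open>Correctness and running time of the preprocessing\<close>

context
  fixes n sg st :: nat and fs x :: "nat list" and ts :: "(nat \<times> nat \<times> nat) list"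
    and m0 :: "nat \<Rightarrow> nat" and b R nf nt lx tp xp :: nat
  assumes nf: "nf = length fs" and nt: "nt = length ts" and lx: "lx = length x"
    and tp: "tp = 6 + nf" and xp: "xp = tp + 3 * nt" and b: "b = xp + lx" and R: "R = n + sg"
    and header: "m0 0 = n" "m0 (Suc 0) = sg" "m0 2 = st" "m0 3 = nf" "m0 4 = nt" "m0 5 = lx"
    and m_fs: "\<And>k. k < nf \<Longrightarrow> m0 (6 + k) = fs ! k"
    and m_ts: "\<And>k p a q. k < nt \<Longrightarrow> ts ! k = (p, a, q) \<Longrightarrow>
      m0 (tp + 3 * k) = p \<and> m0 (tp + 3 * k + 1) = a \<and> m0 (tp + 3 * k + 2) = q"
    and m_x: "\<And>k. k < lx \<Longrightarrow> m0 (xp + k) = x ! k"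
    and st: "st < n" and fs: "\<And>f. f \<in> set fs \<Longrightarrow> f < n"
    and ts: "\<And>p a q. (p, a, q) \<in> set ts \<Longrightarrow> p < n \<and> q < n"
begin

definition env :: "(nat \<Rightarrow> nat) \<Rightarrow> bool" where
  "env r \<longleftrightarrow> r ONE = 1 \<and> r ZERO = 0 \<and> r NQ = n \<and> r RR = R \<and> r BASE = b \<and> r FE = tp \<and> r TE = xp"

definition emitted :: "nat list \<Rightarrow> (nat \<Rightarrow> nat) \<Rightarrow> (nat \<Rightarrow> nat) \<Rightarrow> bool" where
  "emitted zs r m \<longleftrightarrow> m = write_list m0 b zs \<and> r OUT = b + length zs"

lemma wp_setup:
  "wp setup_code (\<lambda>r m \<tau>. env r \<and> r ST = st \<and> r NF = nf \<and> r NT = nt \<and> r XP = xp \<and> r TP = tp \<and>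
     r FP = 6 \<and> m = m0 \<and> \<tau> \<le> 50 + 4 * (nf + 3 * nt + lx + sg)) (\<lambda>_. 0) m0 0"
  unfolding setup_code_def env_def
  apply ((rule wp_seq | (rule wp_do wp_add; (simp add: header)?))+)
  apply (simp add: tp xp b R)
  done

abbreviation "text \<equiv> wb_text n R st x"
text \<open>This bounds one round of each of the three outer loops. The most expensive one, for a
  transition, writes two ranges at \<open>5 * n\<close> each, adds \<open>n\<close> to the letter at
  \<open>4 * n\<close>, and writes the padding at \<open>5 * R\<close>.\<close>

abbreviation "cost \<equiv> 14 * n + 5 * R + 50"

lemma wp_text:
  assumes "env r \<and> r ST = st \<and> r NF = nf \<and> r NT = nt \<and> r XP = xp \<and> r TP = tp \<and> r FP = 6 \<and> m = m0"
  shows "wp text_code (\<lambda>r' m' \<tau>'. env r' \<and> r' TP = tp \<and> r' FP = 6 \<and>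
     emitted (length text # (nt + nf) # text) r' m' \<and> \<tau>' \<le> \<tau> + lx * cost + 20 + 4 * nt + 5 * n) r m \<tau>"
proof -
  define pre where "pre = (nf + nt) # [st..<n]"
  define seg where "seg k = concat (map (\<lambda>a. replicate R (n + a) @ [0..<n]) (take k x))" for k
  \<comment> \<open>Cell \<open>b\<close> is reserved for the length of the text, so the invariant
    describes the output from \<open>Suc b\<close> on.\<close>
  let ?I = "\<lambda>k r' m' \<tau>'. env r' \<and> r' TP = tp \<and> r' FP = 6 \<and> r' XP = xp + k \<and>
    m' = write_list m0 (Suc b) (pre @ seg k) \<and> r' OUT = Suc b + length (pre @ seg k) \<and>
    \<tau>' \<le> \<tau> + 10 + 4 * nt + 5 * n + k * cost"
  have loop: "wp (While XP BASE
       (Do (Load LET XP) ;; add_to LET NQ ;; emit_letter ;; Do (LoadConst VAL 0) ;; emit_range NQ ;;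
        inc XP)) (\<lambda>r' m' \<tau>'. \<exists>\<tau>''. \<tau>' = Suc \<tau>'' \<and> ?I lx r' m' \<tau>'') r m \<tau>"
    if "?I 0 r m \<tau>" for r m \<tau>
  proof (rule wp_While[where K = lx and I = ?I, OF that])
    fix k r m \<tau>' assume k: "k < lx" and I: "?I k r m \<tau>'"
    have "seg (Suc k) = seg k @ replicate R (n + x ! k) @ [0..<n]"
      using k by (simp add: seg_def take_Suc_conv_app_nth lx)
    moreover have "m (xp + k) = x ! k"
      using k I m_x b by simp
    moreover have "xp + k < b" using k b by simp
    moreover note I[unfolded env_def]
    ultimately show "r XP < r BASE \<and> wp (Do (Load LET XP) ;; add_to LET NQ ;; emit_letter ;;
        Do (LoadConst VAL 0) ;; emit_range NQ ;; inc XP) (\<lambda>r m \<tau>. ?I (Suc k) r m (Suc \<tau>)) r m (Suc \<tau>')"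
      unfolding env_def
      apply (elim conjE, intro conjI)
        apply simp
       apply simp
      apply ((rule wp_seq | (rule wp_do wp_blocks; simp?))+)
      apply (simp add: write_list_append' add.commute)
      done
  next
    fix r m \<tau>' assume "?I lx r m \<tau>'"
    then show "\<not> r XP < r BASE \<and> (\<exists>\<tau>''. Suc \<tau>' = Suc \<tau>'' \<and> ?I lx r m \<tau>'')"
      by (simp add: env_def) (simp add: b)
  qed
  show ?thesis
    unfolding text_code_def
    using assms[unfolded env_def] st
    apply (elim conjE)
    apply ((rule wp_seq | (rule wp_do wp_blocks; simp?))+)
    apply (rule wp_conseq[OF loop])
     apply (simp add: seg_def pre_def write_list_append' write_list_single[of m0] env_def)
    apply (elim exE conjE)
    unfolding env_def emitted_def
    apply (elim conjE)
    apply ((rule wp_seq | (rule wp_do wp_blocks; simp?))+)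
    apply (simp add: seg_def pre_def lx wb_text_def write_list_Cons add.commute[of nf nt])
    done
qed

lemma wp_trans:
  assumes "env r \<and> r TP = tp \<and> r FP = 6 \<and> emitted zs r m"
  shows "wp trans_code (\<lambda>r' m' \<tau>'. env r' \<and> r' FP = 6 \<and>
     emitted (zs @ delimited (map (trans_word n R) ts)) r' m' \<and> \<tau>' \<le> \<tau> + nt * cost + 1) r m \<tau>"
  unfolding trans_code_def end_word_def
proof (rule wp_While[where K = nt and I = "\<lambda>k r' m' \<tau>'. env r' \<and> r' TP = tp + 3 * k \<and> r' FP = 6 \<and>
    emitted (zs @ delimited (map (trans_word n R) (take k ts))) r' m' \<and> \<tau>' \<le> \<tau> + k * cost"],
    goal_cases)
  case 1
  then show ?case using assms by simp
next
  case (2 k r m \<tau>')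
  obtain p a q where paq: "ts ! k = (p, a, q)" by (metis prod_cases3)
  then have "p < n" "q < n" using ts 2(1) nt by (metis nth_mem)+
  have "delimited (map (trans_word n R) (take (Suc k) ts)) =
      delimited (map (trans_word n R) (take k ts)) @
      (n - p + (R + q)) # [p..<n] @ replicate R (n + a) @ [0..<q]"
    using 2(1) by (simp add: take_Suc_conv_app_nth nt paq trans_word_def)
  \<comment> \<open>The output starts at \<open>b\<close>, behind the input, so the cells being read
    are still unchanged.\<close>
  moreover have "m (tp + 3 * k) = p" "m (Suc (tp + 3 * k)) = a" "m (Suc (Suc (tp + 3 * k))) = q"
    using 2 m_ts[OF 2(1) paq] b xp unfolding emitted_def by simp_all
  moreover have "tp + 3 * k < xp" using 2(1) xp by simp
  moreover note \<open>p < n\<close> \<open>q < n\<close> 2(2)[unfolded env_def emitted_def]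
  ultimately show ?case
    unfolding env_def emitted_def
    apply (elim conjE, intro conjI)
      apply simp
     apply simp
    apply ((rule wp_seq | (rule wp_do wp_blocks; simp?))+)
    apply (simp add: write_list_append' write_list_Cons add.commute)
    apply (elim conjE, intro conjI; linarith)
    done
next
  case (3 r m \<tau>')
  then show ?case by (simp add: env_def nt) (simp add: xp nt)
qed

lemma wp_final:
  assumes "env r \<and> r FP = 6 \<and> emitted zs r m"
  shows "wp final_code (\<lambda>r' m' \<tau>'. env r' \<and>
     emitted (zs @ delimited (map (final_word n) fs)) r' m' \<and> \<tau>' \<le> \<tau> + nf * cost + 1) r m \<tau>"
  unfolding final_code_def end_word_def
proof (rule wp_While[where K = nf and I = "\<lambda>k r' m' \<tau>'. env r' \<and> r' FP = 6 + k \<and>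
    emitted (zs @ delimited (map (final_word n) (take k fs))) r' m' \<and> \<tau>' \<le> \<tau> + k * cost"],
    goal_cases)
  case 1
  then show ?case using assms by simp
next
  case (2 k r m \<tau>')
  have "fs ! k < n" using fs 2(1) nf by simp
  moreover have "delimited (map (final_word n) (take (Suc k) fs)) =
      delimited (map (final_word n) (take k fs)) @ (n - fs ! k) # [fs ! k..<n]"
    using 2(1) by (simp add: take_Suc_conv_app_nth nf final_word_def)
  moreover have "m (6 + k) = fs ! k"
    using 2 m_fs b xp tp unfolding emitted_def by simp
  moreover have "6 + k < tp" using 2(1) tp by simp
  moreover note 2(2)[unfolded env_def emitted_def]
  ultimately show ?case
    unfolding env_def emitted_def
    apply (elim conjE, intro conjI)
      apply simp
     apply simp
    apply ((rule wp_seq | (rule wp_do wp_blocks; simp?))+)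
    apply (simp add: write_list_append' write_list_Cons add.commute)
    apply (elim conjE, intro conjI; linarith)
    done
next
  case (3 r m \<tau>')
  then show ?case by (simp add: env_def nf) (simp add: tp nf)
qed

lemma wp_prep:
  "wp prep (\<lambda>r m \<tau>. r BASE = b \<and>
     m = write_list m0 b ([length text, nt + nf] @ text @
           delimited (map (trans_word n R) ts @ map (final_word n) fs)) \<and>
     \<tau> \<le> 72 + 4 * (nf + 4 * nt + lx + sg) + 5 * n + (lx + nt + nf) * cost) (\<lambda>_. 0) m0 0"
  unfolding prep_def
proof (rule wp_seq, rule wp_conseq[OF wp_setup], rule wp_seq)
  fix r1 m1 \<tau>1
  assume 1: "env r1 \<and> r1 ST = st \<and> r1 NF = nf \<and> r1 NT = nt \<and> r1 XP = xp \<and> r1 TP = tp \<and>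
    r1 FP = 6 \<and> m1 = m0 \<and> \<tau>1 \<le> 50 + 4 * (nf + 3 * nt + lx + sg)"
  show "wp text_code (wp (trans_code ;; final_code) (\<lambda>r m \<tau>. r BASE = b \<and>
     m = write_list m0 b ([length text, nt + nf] @ text @
           delimited (map (trans_word n R) ts @ map (final_word n) fs)) \<and>
     \<tau> \<le> 72 + 4 * (nf + 4 * nt + lx + sg) + 5 * n + (lx + nt + nf) * cost)) r1 m1 \<tau>1"
  proof (rule wp_conseq[OF wp_text], use 1 in simp, rule wp_seq)
    fix r2 m2 \<tau>2
    assume 2: "env r2 \<and> r2 TP = tp \<and> r2 FP = 6 \<and>
      emitted (length text # (nt + nf) # text) r2 m2 \<and>
      \<tau>2 \<le> \<tau>1 + lx * cost + 20 + 4 * nt + 5 * n"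
    show "wp trans_code (wp final_code (\<lambda>r m \<tau>. r BASE = b \<and>
       m = write_list m0 b ([length text, nt + nf] @ text @
             delimited (map (trans_word n R) ts @ map (final_word n) fs)) \<and>
       \<tau> \<le> 72 + 4 * (nf + 4 * nt + lx + sg) + 5 * n + (lx + nt + nf) * cost)) r2 m2 \<tau>2"
    proof (rule wp_conseq[OF wp_trans], use 2 in blast, rule wp_conseq[OF wp_final], blast)
      fix r3 m3 \<tau>3 r4 m4 \<tau>4
      assume 3: "env r3 \<and> r3 FP = 6 \<and>
          emitted ((length text # (nt + nf) # text) @ delimited (map (trans_word n R) ts)) r3 m3 \<and>
          \<tau>3 \<le> \<tau>2 + nt * cost + 1"
        and 4: "env r4 \<and>
          emitted (((length text # (nt + nf) # text) @ delimited (map (trans_word n R) ts)) @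
            delimited (map (final_word n) fs)) r4 m4 \<and> \<tau>4 \<le> \<tau>3 + nf * cost + 1"
      \<comment> \<open>Hiding the sum behind \<open>c\<close> leaves the products with it as atoms,
        and the four bounds add up linearly.\<close>
      obtain c where c: "cost = c" by blast
      have "\<tau>1 \<le> 50 + 4 * (nf + 3 * nt + lx + sg)"
          "\<tau>2 \<le> \<tau>1 + lx * c + 20 + 4 * nt + 5 * n"
          "\<tau>3 \<le> \<tau>2 + nt * c + 1" "\<tau>4 \<le> \<tau>3 + nf * c + 1"
        using 1 2 3 4 unfolding c by blast+
      then have "\<tau>4 \<le> 72 + 4 * (nf + 4 * nt + lx + sg) + 5 * n + (lx + nt + nf) * cost"
        unfolding c add_mult_distrib by simp
      then show "r4 BASE = b \<and>
          m4 = write_list m0 b ([length text, nt + nf] @ text @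
             delimited (map (trans_word n R) ts @ map (final_word n) fs)) \<and>
          \<tau>4 \<le> 72 + 4 * (nf + 4 * nt + lx + sg) + 5 * n + (lx + nt + nf) * cost"
        using 4 unfolding env_def emitted_def by simp
    qed
  qed
qed

end


section \<open>Correctness of the reduction\<close>

lemma nfa_accepts_Nil: "nfa_accepts M [] \<longleftrightarrow> start M \<in> final M"
  by (auto simp: nfa_accepts_def intro: exI[of _ "\<lambda>_. start M"])

lemma nfa_accepts_Cons:
  "nfa_accepts M (a # x) \<longleftrightarrow>
     (\<exists>q. (start M, a, q) \<in> trans M \<and> nfa_accepts (M\<lparr>start := q\<rparr>) x)"
proof
  assume "nfa_accepts M (a # x)"
  then obtain q where q: "q 0 = start M" "\<And>i. i < length (a # x) \<Longrightarrow> (q i, (a # x) ! i, q (Suc i)) \<in> trans M"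
      "q (length (a # x)) \<in> final M"
    unfolding nfa_accepts_def by blast
  have "(start M, a, q 1) \<in> trans M" using q(1) q(2)[of 0] by simp
  moreover have "nfa_accepts (M\<lparr>start := q 1\<rparr>) x"
    unfolding nfa_accepts_def using q(2)[of "Suc i" for i] q(3)
    by (intro exI[of _ "\<lambda>i. q (Suc i)"]) auto
  ultimately show "\<exists>q. (start M, a, q) \<in> trans M \<and> nfa_accepts (M\<lparr>start := q\<rparr>) x" by blast
next
  assume "\<exists>q. (start M, a, q) \<in> trans M \<and> nfa_accepts (M\<lparr>start := q\<rparr>) x"
  then obtain q f where q: "(start M, a, q) \<in> trans M" "f 0 = q"
      "\<And>i. i < length x \<Longrightarrow> (f i, x ! i, f (Suc i)) \<in> trans M" "f (length x) \<in> final M"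
    unfolding nfa_accepts_def by auto
  show "nfa_accepts M (a # x)"
    unfolding nfa_accepts_def using q
    by (intro exI[of _ "case_nat (start M) f"]) (auto simp: nth_Cons split: nat.split)
qed

lemma word_breakable_iff:
  "word_breakable D S \<longleftrightarrow> S = [] \<or> (\<exists>w \<in> D. \<exists>S'. S = w @ S' \<and> word_breakable D S')"
proof
  assume "word_breakable D S"
  then obtain ws where "set ws \<subseteq> D" "concat ws = S" by (auto simp: word_breakable_def)
  then show "S = [] \<or> (\<exists>w \<in> D. \<exists>S'. S = w @ S' \<and> word_breakable D S')"
    by (cases ws) (auto simp: word_breakable_def)
next
  assume "S = [] \<or> (\<exists>w \<in> D. \<exists>S'. S = w @ S' \<and> word_breakable D S')"
  then show "word_breakable D S"
  proof
    assume "\<exists>w \<in> D. \<exists>S'. S = w @ S' \<and> word_breakable D S'"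
    then obtain w ws where "w \<in> D" "S = w @ concat ws" "set ws \<subseteq> D"
      by (auto simp: word_breakable_def)
    then show ?thesis unfolding word_breakable_def by (intro exI[of _ "w # ws"]) auto
  qed (auto simp: word_breakable_def intro: exI[of _ "[]"])
qed

text \<open>Cutting the range \<open>0, ..., n - 1\<close> of the first block at \<open>q\<close>
  leaves a remainder that is itself a text, with start state \<open>q\<close>. This makes the
  induction over the input string possible.\<close>

lemma wb_text_Cons:
  "q \<le> n \<Longrightarrow> wb_text n R p (a # x) = trans_word n R (p, a, q) @ wb_text n R q x"
  using upt_add_eq_append[of 0 q "n - q"] by (simp add: wb_text_def trans_word_def)

lemma upt_append_eq_iff:
  "p < n \<Longrightarrow> p' < n \<Longrightarrow> [p..<n] @ u = [p'..<n] @ u' \<longleftrightarrow> p = p' \<and> u = (u' :: nat list)"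
  by (auto simp: upt_conv_Cons)

lemma replicate_append_eq_iff:
  "0 < R \<Longrightarrow> replicate R a @ u = replicate R a' @ u' \<longleftrightarrow> a = a' \<and> u = u'"
  by (cases R) auto

text \<open>The first letter reveals \<open>p\<close>, and the non-empty padding reveals
  \<open>a\<close>. The target \<open>q\<close> stays open, since \<open>u\<close> may continue the
  range; this freedom is the nondeterminism of the automaton.\<close>

lemma trans_word_append_eq_iff:
  assumes "p < n" "p' < n" "0 < R"
  shows "trans_word n R (p, a, q) @ u = trans_word n R (p', a', q') @ u' \<longleftrightarrow>
    p = p' \<and> a = a' \<and> [0..<q] @ u = [0..<q'] @ u'"
  using assms by (auto simp: trans_word_def upt_append_eq_iff replicate_append_eq_iff)

context
  fixes M :: "(nat, nat) nfa" and n R :: nat and D :: "nat list set"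
  assumes wf: "wf_nfa M" and st: "states M = {..<n}" and R: "0 < R"
    and D: "D = trans_word n R ` trans M \<union> final_word n ` final M"
begin

text \<open>No word can start in the padding, so a break right before the padding is a dead
  end.\<close>

lemma hd_dict: "w \<in> D \<Longrightarrow> w \<noteq> [] \<and> hd w < n"
  using wf st by (fastforce simp: wf_nfa_def D trans_word_def final_word_def upt_conv_Cons)

lemma word_breakable_text_iff:
  "p < n \<Longrightarrow> word_breakable D (wb_text n R p x) \<longleftrightarrow> nfa_accepts (M\<lparr>start := p\<rparr>) x"
proof (induction x arbitrary: p)
  case Nil
  have tr: "p' < n" "q < n" if "(p', a, q) \<in> trans M" for p' a q
    using that wf st by (auto simp: wf_nfa_def)
  have fin: "f < n" if "f \<in> final M" for f
    using that wf st by (auto simp: wf_nfa_def)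
  \<comment> \<open>The padding letter \<open>n + a\<close> does not occur in
    \<open>[p..<n]\<close>.\<close>
  have "[p..<n] \<noteq> trans_word n R (p', a, q) @ S" for p' a q S
  proof
    assume "[p..<n] = trans_word n R (p', a, q) @ S"
    then have "set (trans_word n R (p', a, q)) \<subseteq> set [p..<n]" by (metis Un_upper1 set_append)
    then show False using R by (auto simp: trans_word_def)
  qed
  moreover have "[p..<n] = final_word n f @ S \<longleftrightarrow> f = p \<and> S = []" if "f \<in> final M" for f S
    using upt_append_eq_iff[of p n f "[]" S] fin[OF that] Nil by (auto simp: final_word_def)
  moreover have "word_breakable D []" by (subst word_breakable_iff) simp
  ultimately have "word_breakable D (wb_text n R p []) \<longleftrightarrow> p \<in> final M"
    using Nil by (subst word_breakable_iff) (auto simp: wb_text_def D bex_Un)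
  then show ?case by (simp add: nfa_accepts_Nil)
next
  case (Cons a x)
  have tr: "p' < n" "q < n" if "(p', b, q) \<in> trans M" for p' b q
    using that wf st by (auto simp: wf_nfa_def)
  have fin: "f < n" if "f \<in> final M" for f
    using that wf st by (auto simp: wf_nfa_def)
  have split: "wb_text n R p (a # x) = trans_word n R (p, b, q) @ S \<longleftrightarrow> b = a \<and> S = wb_text n R q x"
    if "q < n" for b q S
    using that Cons.prems R wb_text_Cons[of q n R p a x] by (auto simp: trans_word_append_eq_iff)
  show ?case
  proof
    assume "word_breakable D (wb_text n R p (a # x))"
    moreover have "wb_text n R p (a # x) \<noteq> []" using Cons.prems by (simp add: wb_text_def)
    ultimately obtain w S where w: "w \<in> D" "wb_text n R p (a # x) = w @ S" "word_breakable D S"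
      by (subst (asm) word_breakable_iff) blast
    from w(1) show "nfa_accepts (M\<lparr>start := p\<rparr>) (a # x)"
      unfolding D
    proof
      assume "w \<in> trans_word n R ` trans M"
      then obtain p' b q where b: "(p', b, q) \<in> trans M" "w = trans_word n R (p', b, q)" by auto
      \<comment> \<open>Splitting the text at the arbitrary state 0 exposes enough of its beginning
        for the comparison.\<close>
      have "p' = p"
        using w(2) wb_text_Cons[of 0 n R p a x] Cons.prems tr[OF b(1)] R
        by (simp add: b(2) trans_word_append_eq_iff)
      then have "b = a" "S = wb_text n R q x" using w(2) split tr[OF b(1)] b(2) by auto
      then have "nfa_accepts (M\<lparr>start := q\<rparr>) x" using Cons.IH w(3) tr[OF b(1)] by blast
      then show ?thesis using b(1) \<open>p' = p\<close> \<open>b = a\<close> by (auto simp: nfa_accepts_Cons)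
    next
      assume "w \<in> final_word n ` final M"
      then obtain f where f: "f \<in> final M" "w = [f..<n]" by (auto simp: final_word_def)
      \<comment> \<open>A final word used too early leaves a rest that starts with padding, which
        contradicts \<open>hd_dict\<close>.\<close>
      have S: "S = replicate R (n + a) @ wb_text n R 0 x"
        using w(2) Cons.prems fin[OF f(1)] by (simp add: f(2) wb_text_def upt_append_eq_iff)
      then have "S \<noteq> []" using R by simp
      then obtain w' S' where "w' \<in> D" "S = w' @ S'"
        using w(3) by (subst (asm) word_breakable_iff) blast
      then have "hd S < n" using hd_dict by auto
      then show ?thesis using S R by (cases R) auto
    qed
  next
    assume "nfa_accepts (M\<lparr>start := p\<rparr>) (a # x)"
    then obtain q where q: "(p, a, q) \<in> trans M" "nfa_accepts (M\<lparr>start := q\<rparr>) x"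
      by (auto simp: nfa_accepts_Cons)
    have "word_breakable D (wb_text n R q x)" using Cons.IH q tr[OF q(1)] by simp
    moreover have "trans_word n R (p, a, q) \<in> D" using q(1) by (auto simp: D)
    ultimately show "word_breakable D (wb_text n R p (a # x))"
      using tr[OF q(1)] by (subst word_breakable_iff) (auto simp: wb_text_Cons[of q])
  qed
qed

text \<open>The encoding lists each word once, and the preprocessing removes no duplicates. With
  nothing following, the length of the last range determines \<open>q\<close>; the padding letter,
  being at least \<open>n\<close>, tells transition words from final words.\<close>

lemma distinct_words:
  assumes "distinct ts" "set ts = trans M" "distinct fs" "set fs = final M"
  shows "distinct (map (trans_word n R) ts @ map (final_word n) fs)"
proof -
  have tr: "p < n" "q < n" if "(p, b, q) \<in> trans M" for p b q
    using that wf st by (auto simp: wf_nfa_def)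
  have fin: "f < n" if "f \<in> final M" for f
    using that wf st by (auto simp: wf_nfa_def)
  have "inj_on (trans_word n R) (trans M)"
  proof (rule inj_onI)
    fix t t' assume t: "t \<in> trans M" "t' \<in> trans M" "trans_word n R t = trans_word n R t'"
    obtain p a q p' a' q' where [simp]: "t = (p, a, q)" "t' = (p', a', q')"
      by (metis prod_cases3)
    have "p = p' \<and> a = a' \<and> [0..<q] = [0..<q']"
      using trans_word_append_eq_iff[of p n p' R a q "[]" a' q' "[]"] tr R t by simp
    then show "t = t'" by simp (metis length_upt minus_nat.diff_0)
  qed
  moreover have "inj_on (final_word n) (final M)"
    by (rule inj_onI) (use fin upt_append_eq_iff[of _ n _ "[]" "[]"] in \<open>auto simp: final_word_def\<close>)
  moreover have "trans_word n R t \<noteq> final_word n f" for t f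
  proof
    assume "trans_word n R t = final_word n f"
    then have "set (trans_word n R t) = set (final_word n f)" by simp
    then show False using R by (cases t) (auto simp: trans_word_def final_word_def)
  qed
  ultimately show ?thesis using assms by (auto simp: distinct_map)
qed

end

section \<open>Size of the reduced instance and transfer of algorithms\<close>

lemma total_length_set: "distinct ws \<Longrightarrow> total_length (set ws) = sum_list (map length ws)"
  by (simp add: total_length_def sum_list_distinct_conv_sum_set)

lemma length_wb_text: "length (wb_text n R p x) = (n - p) + length x * (R + n)"
  by (induction x) (simp_all add: wb_text_def)

definition reduction :: "program \<Rightarrow> program" where
  "reduction P = compile 0 prep @ embed (clen prep) P"

context
  fixes M :: "(nat, nat) nfa" and x xs :: "nat list" and n R :: nat and S D
  assumes inst: "(M, x) \<in> nfa_instances" and enc: "nfa_encoding (M, x) xs" and x: "x \<noteq> []"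
    and n: "n = card (states M)" and R: "R = n + card (alphabet M)"
    and S: "S = wb_text n R (start M) x"
    and D: "D = trans_word n R ` trans M \<union> final_word n ` final M"
begin

lemma M: "wf_nfa M" "states M = {..<n}" "alphabet M = {..<card (alphabet M)}" "set x \<subseteq> alphabet M"
  using inst by (auto simp: nfa_instances_def n)

lemma start_less: "start M < n" and n_le_R: "n \<le> R" and R_pos: "0 < R"
  using M by (auto simp: wf_nfa_def R)

lemma trans_less: "(p, a, q) \<in> trans M \<Longrightarrow> p < n \<and> a < card (alphabet M) \<and> q < n"
  using M(1,2) M(3) by (auto simp: wf_nfa_def)

lemma final_less: "f \<in> final M \<Longrightarrow> f < n"
  using M(1,2) by (auto simp: wf_nfa_def)

lemma finite_trans: "finite (trans M)"
  using M(1) by (auto simp: wf_nfa_def intro: finite_subset)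

lemma card_final_le: "card (final M) \<le> n"
  using card_mono[of "{..<n}" "final M"] final_less by (auto simp: subset_iff)

lemma breakable: "word_breakable D S \<longleftrightarrow> nfa_accepts M x"
  using word_breakable_text_iff[OF M(1,2) R_pos D start_less] by (simp add: S)

text \<open>As \<open>x\<close> is non-empty there is at least one block. Its padding gives
  \<open>R \<le> length S\<close>, by which the letters satisfy the bound in
  \<open>wb_instances\<close>.\<close>

lemma text_bounds: "n * length x \<le> length S" "R \<le> length S" "length S \<le> n + length x * (R + n)"
proof -
  have len: "length S = n - start M + length x * (R + n)" by (simp add: S length_wb_text)
  have "1 \<le> length x" using x by (cases x) auto
  then have "1 * (R + n) \<le> length x * (R + n)" by (rule mult_right_mono) simp
  then show "n * length x \<le> length S" "R \<le> length S" "length S \<le> n + length x * (R + n)"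
    by (auto simp: len algebra_simps)
qed

text \<open>The padding alone gives a transition word \<open>R \<ge> n\<close> letters, whatever its
  states are.\<close>

lemma dict_bounds:
  "n * card (trans M) \<le> total_length D" "total_length D \<le> card (trans M) * (R + 2 * n) + n * n"
proof -
  obtain ts where ts: "distinct ts" "set ts = trans M"
    using finite_distinct_list[OF finite_trans] by blast
  have "finite (final M)" using final_less by (meson bounded_nat_set_is_finite)
  then obtain fs where fs: "distinct fs" "set fs = final M"
    using finite_distinct_list by blast
  have "D = set (map (trans_word n R) ts @ map (final_word n) fs)"
    by (simp add: D ts fs)
  then have tl: "total_length D = (\<Sum>t\<leftarrow>ts. length (trans_word n R t)) + (\<Sum>f\<leftarrow>fs. length (final_word n f))"
    using total_length_set[OF distinct_words[OF M(1,2) R_pos refl ts fs]] by (simp add: o_def)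
  have len: "length ts = card (trans M)" "length fs \<le> n"
    using ts fs card_final_le by (auto simp: distinct_card[symmetric])
  have t: "n \<le> length (trans_word n R t) \<and> length (trans_word n R t) \<le> R + 2 * n"
    if "t \<in> set ts" for t
  proof (cases t)
    case (fields p a q)
    then show ?thesis using that trans_less[of p a q] n_le_R by (auto simp: ts trans_word_def)
  qed
  have "(\<Sum>t\<leftarrow>ts. n) \<le> (\<Sum>t\<leftarrow>ts. length (trans_word n R t))"
    by (intro sum_list_mono) (use t in blast)
  then show "n * card (trans M) \<le> total_length D"
    by (simp add: tl sum_list_triv len mult.commute)
  have "(\<Sum>t\<leftarrow>ts. length (trans_word n R t)) \<le> (\<Sum>t\<leftarrow>ts. R + 2 * n)"
    by (intro sum_list_mono) (use t in blast)
  also have "\<dots> = card (trans M) * (R + 2 * n)" by (simp add: sum_list_triv len)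
  finally have 1: "(\<Sum>t\<leftarrow>ts. length (trans_word n R t)) \<le> card (trans M) * (R + 2 * n)" .
  have "(\<Sum>f\<leftarrow>fs. length (final_word n f)) \<le> (\<Sum>f\<leftarrow>fs. n)"
    by (intro sum_list_mono) (simp add: final_word_def)
  also have "\<dots> \<le> n * n" using len(2) by (simp add: sum_list_triv)
  finally show "total_length D \<le> card (trans M) * (R + 2 * n) + n * n"
    using 1 by (simp add: tl)
qed

lemma letters_less: "w \<in> insert S D \<Longrightarrow> a \<in> set w \<Longrightarrow> a < R"
  using M(3,4) start_less trans_less final_less
  by (fastforce simp: S D wb_text_def trans_word_def final_word_def R)

lemma wb_instance: "(S, D) \<in> wb_instances"
proof -
  have "finite (final M)" using final_less by (meson bounded_nat_set_is_finite)
  then have "finite D" using finite_trans by (simp add: D)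
  then show ?thesis
    using letters_less text_bounds(2) by (force simp: wb_instances_def)
qed

text \<open>The preprocessing contributes the term with \<open>R\<close>, and the embedding doubles
  \<open>B\<close>. The produced instance has input size at most the fourth power of the original
  one, which gives \<open>4 * k\<close> in the exponent; the 6 absorbs the remaining summands and
  constants.\<close>

lemma transfer:
  assumes P: "\<And>ys. wb_encoding (S, D) ys \<Longrightarrow>
      \<exists>T. real T \<le> B \<and> decides P k ys (word_breakable D S) T"
  shows "\<exists>T. real T \<le> 200 * real (length x + card (trans M) + n) * real R + 2 * B \<and>
      decides (reduction P) (4 * k + 6) xs (nfa_accepts M x) T"
proof -
  obtain ts fs where ts: "distinct ts" "set ts = trans M" and fs: "distinct fs" "set fs = final M"
    and xs: "xs = [n, card (alphabet M), start M, length fs, length ts, length x]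
          @ fs @ concat (map (\<lambda>(p, a, q). [p, a, q]) ts) @ x"
    using enc by (auto simp: nfa_encoding_def n)
  let ?sg = "card (alphabet M)"
  let ?f = "\<lambda>(p, a, q). [p, a, q :: nat]"
  let ?nf = "length fs" and ?nt = "length ts" and ?lx = "length x"
  define ws where "ws = map (trans_word n R) ts @ map (final_word n) fs"
  define ys where "ys = [length S, ?nt + ?nf] @ S @ delimited ws"
  have dist: "distinct ws"
    unfolding ws_def by (rule distinct_words[OF M(1,2) R_pos refl ts fs])
  have set_ws: "set ws = D" by (simp add: ws_def D ts fs)
  have "length ws = ?nt + ?nf" by (simp add: ws_def)
  note len_ws = this
  have "wb_encoding (S, D) ys"
    unfolding wb_encoding_def using dist set_ws len_ws by (auto simp: ys_def)
  from P[OF this] obtain T where T: "real T \<le> B" "decides P k ys (nfa_accepts M x) T"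
    by (auto simp: breakable)
  have len3: "length (?f t) = 3" for t by (cases t) simp
  note len_ts = length_concat_map_const[of ?f, OF len3]
  have len_xs: "length xs = 6 + ?nf + 3 * ?nt + ?lx"
    by (simp add: xs len_ts)
  define m0 where "m0 = mem (init xs)"
  have m0: "m0 a = xs ! a" if "a < length xs" for a using that by (simp add: m0_def init_def)
  define T0 where "T0 = 72 + 4 * (?nf + 4 * ?nt + ?lx + ?sg) + 5 * n +
      (?lx + ?nt + ?nf) * (14 * n + 5 * R + 50)"
  have "wp prep (\<lambda>r m \<tau>. r BASE = length xs \<and>
     m = write_list m0 (length xs) ([length (wb_text n R (start M) x), ?nt + ?nf] @
           wb_text n R (start M) x @ delimited (map (trans_word n R) ts @ map (final_word n) fs)) \<and>
     \<tau> \<le> T0) (\<lambda>_. 0) m0 0"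
    unfolding T0_def
  proof (rule wp_prep[where sg = ?sg and tp = "6 + ?nf" and xp = "6 + ?nf + 3 * ?nt"])
    show "m0 0 = n" "m0 (Suc 0) = ?sg" "m0 2 = start M" "m0 3 = ?nf" "m0 4 = ?nt" "m0 5 = ?lx"
      by (subst m0, simp add: len_xs, simp add: xs)+
    show "m0 (6 + k) = fs ! k" if "k < ?nf" for k
      using that by (subst m0) (simp_all add: len_xs, simp add: xs nth_append)
    show "m0 (6 + ?nf + 3 * ?nt + k) = x ! k" if "k < ?lx" for k
      using that by (subst m0) (simp_all add: len_xs, simp add: xs nth_append len_ts)
    fix k p a q assume k: "k < ?nt" "ts ! k = (p, a, q)"
    have "m0 (6 + ?nf + 3 * k + j) = ?f (ts ! k) ! j" if "j < 3" for j
    proof -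
      have "3 * k + j < 3 * ?nt" using k(1) that by linarith
      then have "m0 (6 + ?nf + 3 * k + j) = concat (map ?f ts) ! (3 * k + j)"
        by (subst m0) (simp_all add: len_xs, simp add: xs nth_append len_ts add.assoc)
      then show ?thesis using nth_concat_map_const[OF len3 k(1) that] by simp
    qed
    from this[of 0] this[of 1] this[of 2]
    show "m0 (6 + ?nf + 3 * k) = p \<and> m0 (6 + ?nf + 3 * k + 1) = a \<and> m0 (6 + ?nf + 3 * k + 2) = q"
      by (simp add: k(2))
  qed (use start_less trans_less final_less ts fs in \<open>auto simp: len_xs R\<close>)
  then have wp: "wp prep (\<lambda>r m \<tau>. r BASE = length xs \<and>
     m = write_list (mem (init xs)) (length xs) ys \<and> \<tau> \<le> T0) (\<lambda>_. 0) (mem (init xs)) 0"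
    by (simp add: ys_def ws_def S m0_def)

  let ?I = "input_size xs"
  have nf: "?nf \<le> n" using card_final_le fs by (auto simp: distinct_card[symmetric])
  have nt: "?nt = card (trans M)" using ts by (auto simp: distinct_card[symmetric])
  have "n \<le> Max (set (0 # xs))" "?sg \<le> Max (set (0 # xs))"
    by (rule Max_ge[OF finite_set], simp add: xs)+
  then have I: "8 \<le> ?I" "n \<le> ?I" "?sg \<le> ?I" "?lx + ?nt + ?nf \<le> ?I" "?nt \<le> ?I" "?lx \<le> ?I"
    by (auto simp: input_size_def len_xs)
  have RI: "R \<le> 2 * ?I" using I by (simp add: R)
  \<comment> \<open>The header alone forces \<open>?I \<ge> 8\<close>, so constant factors can be
    traded for higher powers of \<open>?I\<close>.\<close>
  have I2: "8 * ?I \<le> ?I ^ 2" using I(1) by (simp add: power2_eq_square)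
  have I4: "64 * ?I ^ 2 \<le> ?I ^ 4"
    using mult_mono[OF I2 I2] by (simp add: power2_eq_square power4_eq_xxxx)
  have T0_I: "T0 \<le> ?I ^ 4"
  proof -
    have "(?lx + ?nt + ?nf) * (14 * n + 5 * R + 50) \<le> ?I * (24 * ?I + 50)"
      by (intro mult_mono) (use I RI in auto)
    also have "\<dots> = 24 * ?I ^ 2 + 50 * ?I" by (simp add: power2_eq_square algebra_simps)
    finally have "T0 \<le> 72 + 25 * ?I + (24 * ?I ^ 2 + 50 * ?I)"
      unfolding T0_def using I by simp
    then show ?thesis using I(1) I2 I4 by linarith
  qed
  have len_ys: "length ys = 2 + length S + length ws + total_length D"
    using total_length_set[OF dist] set_ws by (simp add: ys_def length_concat o_def sum_list_Suc)
  have "y \<le> length ys + R" if "y \<in> set (0 # ys)" for y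
  proof -
    have "y = 0 \<or> y = length S \<or> y = length ws \<or> y \<in> set S \<or>
        (\<exists>w \<in> set ws. y = length w \<or> y \<in> set w)"
      using that by (auto simp: ys_def len_ws)
    then consider "y = 0" | "y = length S" | "y = length ws" | "y \<in> set S"
      | w where "w \<in> set ws" "y = length w \<or> y \<in> set w"
      by blast
    then show ?thesis
    proof cases
      case 5
      have "length w \<le> sum_list (map length ws)"
        using 5(1) by (intro member_le_sum_list) auto
      then have "length w \<le> total_length D" using total_length_set[OF dist] set_ws by simp
      then show ?thesis using 5 letters_less[of w y] set_ws len_ys by auto
    qed (use letters_less[of S y] len_ys in auto)
  qed
  then have "Max (set (0 # ys)) \<le> length ys + R" by (intro Max.boundedI) auto
  then have "input_size ys \<le> 2 + 2 * length ys + R" by (simp add: input_size_def)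
  also have "\<dots> \<le> ?I ^ 4"
  proof -
    have "length S \<le> ?I + 3 * ?I ^ 2"
    proof -
      have "?lx * (R + n) \<le> ?I * (3 * ?I)" by (intro mult_mono) (use I RI in auto)
      then show ?thesis using text_bounds(3) I(2) by (simp add: power2_eq_square)
    qed
    moreover have "total_length D \<le> 5 * ?I ^ 2"
    proof -
      have "?nt * (R + 2 * n) \<le> ?I * (4 * ?I)" by (intro mult_mono) (use I RI in auto)
      moreover have "n * n \<le> ?I * ?I" by (intro mult_mono) (use I in auto)
      ultimately show ?thesis using dict_bounds(2) by (simp add: power2_eq_square nt)
    qed
    moreover have "length ws \<le> ?I" using I(4) by (simp add: ws_def)
    ultimately show ?thesis using len_ys I(1) I2 I4 RI by linarith
  qed
  finally have "input_size ys ^ k \<le> ?I ^ (4 * k)"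
    by (simp add: power_mono power_mult)
  also have "\<dots> \<le> ?I ^ (4 * k + 4)" using I(1) by (intro power_increasing) auto
  finally have 1: "input_size ys ^ k \<le> ?I ^ (4 * k + 4)" .
  have 2: "?I ^ 4 \<le> ?I ^ (4 * k + 4)" using I(1) by (intro power_increasing) auto
  have "8 \<le> ?I ^ 2" using I(1) I2 by linarith
  then have "8 * ?I ^ (4 * k + 4) \<le> ?I ^ 2 * ?I ^ (4 * k + 4)" by (rule mult_right_mono) simp
  also have "\<dots> = ?I ^ (4 * k + 6)" by (simp add: add.commute flip: power_add)
  finally have 3: "8 * ?I ^ (4 * k + 4) \<le> ?I ^ (4 * k + 6)" .
  have size: "?I + T0 + input_size ys ^ k \<le> ?I ^ (4 * k + 6)"
    using 1 2 3 T0_I I(1) I2 I4 by linarith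
  have "6 \<le> ?I" using I(1) by simp
  from decides_reduction[OF wp safe_prep T(2) this size]
  obtain T' where T': "T' \<le> T0 + 2 * T" "decides (reduction P) (4 * k + 6) xs (nfa_accepts M x) T'"
    by (auto simp: reduction_def)
  let ?W = "?lx + ?nt + n"
  have "T0 \<le> 200 * ?W * R"
  proof -
    define w where "w = ?W * R"
    have w: "1 \<le> w" "R \<le> w"
      using R_pos start_less by (simp_all add: w_def Suc_le_eq)
    have "?nf + 4 * ?nt + ?lx \<le> 4 * (?W * 1)" using nf by simp
    also have "\<dots> \<le> 4 * w" unfolding w_def using R_pos by (intro mult_left_mono) auto
    finally have "4 * (?nf + 4 * ?nt + ?lx + ?sg) \<le> 20 * w" using w(2) by (simp add: R)
    moreover have "5 * n \<le> 5 * w" using w(2) n_le_R by simp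
    moreover have "(?lx + ?nt + ?nf) * (14 * n + 5 * R + 50) \<le> ?W * (69 * R)"
      by (intro mult_mono) (use nf n_le_R R_pos in auto)
    then have "(?lx + ?nt + ?nf) * (14 * n + 5 * R + 50) \<le> 69 * w" by (simp add: w_def)
    ultimately have "T0 \<le> 72 + 20 * w + 5 * w + 69 * w"
      unfolding T0_def by (intro add_mono order_refl)
    then have "T0 \<le> 200 * w" using w(1) by simp
    then show ?thesis by (simp only: w_def mult.assoc)
  qed
  then have "real T0 \<le> real (200 * ?W * R)" by (rule of_nat_mono)
  then have "real T' \<le> 200 * real (?lx + card (trans M) + n) * real R + 2 * B"
    using T'(1) T(1) by (simp add: nt)
  then show ?thesis using T'(2) by blast
qed

end


section \<open>Parameters\<close>

text \<open>As \<open>(1 + \<beta>) * \<gamma> = 3\<close>, the power \<open>N powr \<gamma>\<close>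
  is \<open>n powr 3\<close> up to a factor \<open>K powr \<gamma>\<close>, and \<open>m\<close> is
  so up to a factor \<open>K\<close>.\<close>

lemma theta_bounded_powr:
  fixes n K N m \<beta> \<gamma> :: real
  assumes "1 \<le> n" "1 \<le> K" "0 < \<gamma>" "(1 + \<beta>) * \<gamma> = 3"
    and N: "n powr (1 + \<beta>) / K \<le> N" "N \<le> K * n powr (1 + \<beta>)"
    and m: "n powr 3 / K \<le> m" "m \<le> K * n powr 3"
  shows "theta_bounded (K * K powr \<gamma>) m (N powr \<gamma>)"
proof -
  have n3: "(n powr (1 + \<beta>)) powr \<gamma> = n powr 3"
    by (simp add: powr_powr assms(4))
  have N0: "0 \<le> N" using N(1) assms(1,2) by (meson divide_nonneg_nonneg order_trans powr_ge_zero zero_le_one)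
  have "N powr \<gamma> \<le> (K * n powr (1 + \<beta>)) powr \<gamma>"
    using N(2) N0 assms(3) by (intro powr_mono2) auto
  then have 1: "N powr \<gamma> \<le> K powr \<gamma> * n powr 3"
    using assms(2) by (simp add: powr_mult n3)
  have "n powr (1 + \<beta>) \<le> K * N"
    using N(1) assms(2) by (simp add: field_simps)
  then have "(n powr (1 + \<beta>)) powr \<gamma> \<le> (K * N) powr \<gamma>"
    using assms(3) by (intro powr_mono2) auto
  then have 2: "n powr 3 \<le> K powr \<gamma> * N powr \<gamma>"
    using assms(2) N0 by (simp add: powr_mult n3)
  have K: "0 < K" "0 < K powr \<gamma>" using assms(2) by auto
  have "N powr \<gamma> / (K * K powr \<gamma>) \<le> n powr 3 / K"
    using 1 K by (simp add: field_simps)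
  moreover have "K * n powr 3 \<le> K * (K powr \<gamma> * N powr \<gamma>)"
    using 2 K by (intro mult_left_mono) auto
  ultimately show ?thesis
    using m by (simp add: theta_bounded_def mult.assoc)
qed

text \<open>The choice of \<open>\<epsilon>'\<close> makes the exponent of \<open>n\<close> on the
  right \<open>E = 2 + \<beta> - min (3 * \<epsilon>) (\<beta> - 1)\<close>. The first argument of
  the minimum leaves room for the product term, the second for the cubic dictionary size and the
  preprocessing of transitions.\<close>

lemma time_bound:
  fixes n K N m l t R \<beta> \<epsilon> \<epsilon>' :: real
  assumes n: "1 \<le> n" and K: "1 \<le> K" and "0 < \<epsilon>" "\<epsilon> < 1 / 3" "1 < \<beta>"
    and \<epsilon>': "\<epsilon>' = min (3 * \<epsilon>) (\<beta> - 1) / (2 + \<beta>)"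
    and N: "0 \<le> N" "N \<le> K * n powr (1 + \<beta>)"
    and m: "0 \<le> m" "m \<le> K * n powr 3"
    and l: "n powr \<beta> / K \<le> l" "l \<le> K * n powr \<beta>"
    and t: "n powr 2 / K \<le> t" "t \<le> K * n powr 2"
    and R: "0 \<le> R" "R \<le> K * n"
  shows "N * m powr (1 / 3 - \<epsilon>) + m + 200 * (l + t + n) * R \<le> 700 * K ^ 4 * (t * l) powr (1 - \<epsilon>')"
proof -
  define E where "E = (2 + \<beta>) * (1 - \<epsilon>')"
  have "E = 2 + \<beta> - min (3 * \<epsilon>) (\<beta> - 1)"
    using assms(5) by (simp add: E_def \<epsilon>' right_diff_distrib)
  \<comment> \<open>The three exponents belong to the product
    \<open>N * m powr (1 / 3 - \<epsilon>)\<close>, to \<open>m\<close> and \<open>t * R\<close>,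
    and to \<open>l * R\<close>. The last one fits because
    \<open>3 * \<epsilon> < 1\<close>.\<close>
  then have E: "2 + \<beta> - 3 * \<epsilon> \<le> E" "3 \<le> E" "1 + \<beta> \<le> E" using assms(4) by auto
  have "0 < (2 + \<beta>) * (1 - \<epsilon>')" using E(2) by (simp flip: E_def)
  then have e1: "0 < 1 - \<epsilon>'" using assms(5) by (simp add: zero_less_mult_iff)
  have e0: "0 < \<epsilon>'" using assms(3,5) by (simp add: \<epsilon>')
  have nE: "n powr a \<le> n powr E" if "a \<le> E" for a using that n by (intro powr_mono) auto
  have KK: "K \<le> K ^ 2" "1 \<le> K ^ 2" using self_le_power[OF K, of 2] one_le_power[OF K] by simp_all

  have "m powr (1 / 3 - \<epsilon>) \<le> (K * n powr 3) powr (1 / 3 - \<epsilon>)"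
    using m assms(4) by (intro powr_mono2) auto
  also have "\<dots> = K powr (1 / 3 - \<epsilon>) * n powr (1 - 3 * \<epsilon>)"
    using K by (simp add: powr_mult powr_powr algebra_simps)
  also have "\<dots> \<le> K * n powr (1 - 3 * \<epsilon>)"
    using powr_mono[of "1 / 3 - \<epsilon>" 1 K] K assms(3) by (intro mult_right_mono) auto
  finally have "N * m powr (1 / 3 - \<epsilon>) \<le> (K * n powr (1 + \<beta>)) * (K * n powr (1 - 3 * \<epsilon>))"
    using N K by (intro mult_mono) auto
  also have "\<dots> = K ^ 2 * n powr (2 + \<beta> - 3 * \<epsilon>)"
    using n by (simp add: power2_eq_square flip: powr_add) (simp add: algebra_simps)
  also have "\<dots> \<le> K ^ 2 * n powr E" using nE[OF E(1)] by (intro mult_left_mono) auto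
  finally have 1: "N * m powr (1 / 3 - \<epsilon>) \<le> K ^ 2 * n powr E" .
  have "K * n powr 3 \<le> K ^ 2 * n powr E" using nE[OF E(2)] KK K by (intro mult_mono) auto
  then have 2: "m \<le> K ^ 2 * n powr E" using m by linarith
  have "(l + t + n) * R \<le> (K * n powr \<beta> + K * n powr 2 + K * n powr 1) * (K * n powr 1)"
    using l t R n K by (intro mult_mono add_mono) (auto intro: order_trans[OF _ mult_right_mono[of 1 K n]])
  also have "\<dots> = K ^ 2 * (n powr (1 + \<beta>) + n powr 3 + n powr 2)"
    using n unfolding powr_add by (simp add: power2_eq_square powr_numeral algebra_simps eval_nat_numeral)
  also have "\<dots> \<le> K ^ 2 * (n powr E + n powr E + n powr E)"
    using nE E by (intro mult_left_mono add_mono) auto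
  finally have 3: "(l + t + n) * R \<le> 3 * (K ^ 2 * n powr E)" by simp

  have "n powr (2 + \<beta>) / K ^ 2 = (n powr 2 / K) * (n powr \<beta> / K)"
    by (simp add: powr_add power2_eq_square)
  also have "\<dots> \<le> t * l"
    using l t K by (intro mult_mono) (auto intro: order_trans[rotated])
  finally have "n powr (2 + \<beta>) \<le> K ^ 2 * (t * l)" using K by (simp add: field_simps)
  then have "(n powr (2 + \<beta>)) powr (1 - \<epsilon>') \<le> (K ^ 2 * (t * l)) powr (1 - \<epsilon>')"
    using e1 by (intro powr_mono2) auto
  also have "\<dots> = (K ^ 2) powr (1 - \<epsilon>') * (t * l) powr (1 - \<epsilon>')"
    by (rule powr_mult)
  also have "\<dots> \<le> K ^ 2 * (t * l) powr (1 - \<epsilon>')"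
    using powr_mono[of "1 - \<epsilon>'" 1 "K ^ 2"] KK e0 by (intro mult_right_mono) auto
  finally have F: "n powr E \<le> K ^ 2 * (t * l) powr (1 - \<epsilon>')"
    by (simp add: powr_powr E_def)
  have "N * m powr (1 / 3 - \<epsilon>) + m + 200 * (l + t + n) * R \<le> 700 * (K ^ 2 * n powr E)"
  proof -
    have "0 \<le> K ^ 2 * n powr E" "200 * (l + t + n) * R = 200 * ((l + t + n) * R)" by simp_all
    then show ?thesis using 1 2 3 by linarith
  qed
  also have "\<dots> \<le> 700 * (K ^ 2 * (K ^ 2 * (t * l) powr (1 - \<epsilon>')))"
    using F by (intro mult_left_mono) auto
  also have "\<dots> = 700 * K ^ 4 * (t * l) powr (1 - \<epsilon>')"
    by (simp add: power2_eq_square power4_eq_xxxx)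
  finally show ?thesis .
qed

text \<open>This yields \<open>R = O(n)\<close>. Once \<open>g n < 1\<close> the bound is clear, and
  the finitely many earlier values are absorbed by the sum in \<open>A\<close>.\<close>

lemma linear_bound_of_o1:
  fixes g :: "nat \<Rightarrow> real"
  assumes "g \<longlonglongrightarrow> 0"
  obtains A where "0 \<le> A" "\<And>n. 1 \<le> n \<Longrightarrow> real n powr g n \<le> A * real n"
proof -
  have "\<forall>\<^sub>F n in sequentially. g n < 1" using assms by (rule order_tendstoD) simp
  then obtain n0 where n0: "\<And>n. n0 \<le> n \<Longrightarrow> g n < 1" by (auto simp: eventually_sequentially)
  define A where "A = 1 + (\<Sum>i<n0. real i powr g i)"
  have A: "1 \<le> A" by (simp add: A_def sum_nonneg)
  have "real n powr g n \<le> A * real n" if n: "1 \<le> n" for n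
  proof (cases "n < n0")
    case True
    then have "real n powr g n \<le> A"
      using member_le_sum[of n "{..<n0}" "\<lambda>i. real i powr g i"] by (simp add: A_def)
    also have "\<dots> \<le> A * real n" using mult_left_mono[of 1 "real n" A] A n by simp
    finally show ?thesis .
  next
    case False
    then have "real n powr g n \<le> real n powr 1" using n n0[of n] by (intro powr_mono) auto
    also have "\<dots> \<le> A * real n" using mult_right_mono[of 1 A "real n"] A n by simp
    finally show ?thesis .
  qed
  then show ?thesis using that[of A] A by simp
qed

section \<open>Monotonicity of solvability and the hardness results\<close>

lemma solvable_in_time_mono:
  assumes "solvable_in_time I enc yes f" "J \<subseteq> I" "\<And>x. x \<in> J \<Longrightarrow> 0 \<le> f x \<and> f x \<le> g x"
  shows "solvable_in_time J enc yes g"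
proof -
  obtain P k C where P: "\<And>x xs. x \<in> I \<Longrightarrow> enc x xs \<Longrightarrow>
      \<exists>T. real T \<le> C * (1 + f x) \<and> decides P k xs (yes x) T"
    using assms(1) unfolding solvable_in_time_def by blast
  \<comment> \<open>The constant \<open>C\<close> may be negative, so its absolute value is
    used.\<close>
  have "C * (1 + f x) \<le> \<bar>C\<bar> * (1 + g x)" if "x \<in> J" for x
    using assms(3)[OF that] by (intro mult_mono) auto
  then have "\<forall>x \<in> J. \<forall>xs. enc x xs \<longrightarrow>
      (\<exists>T. real T \<le> \<bar>C\<bar> * (1 + g x) \<and> decides P k xs (yes x) T)"
    using P assms(2) by (meson order_trans subsetD)
  then show ?thesis unfolding solvable_in_time_def by blast
qed

lemma wb_solvable_fast_mono:
  assumes "wb_solvable_fast I \<epsilon>" "J \<subseteq> I" "\<epsilon>' \<le> \<epsilon>"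
  shows "wb_solvable_fast J \<epsilon>'"
  unfolding wb_solvable_fast_def
proof (rule solvable_in_time_mono[OF assms(1)[unfolded wb_solvable_fast_def] assms(2)], clarify, rule conjI)
  fix S :: "nat list" and D :: "nat list set"
  show "0 \<le> real (length S) * real (total_length D) powr (1 / 3 - \<epsilon>) + real (total_length D)" by simp
  \<comment> \<open>Total length 0 is separate, as \<open>0 powr\<close> any exponent is 0;
    otherwise the base is at least 1.\<close>
  have "real (total_length D) powr (1 / 3 - \<epsilon>) \<le> real (total_length D) powr (1 / 3 - \<epsilon>')"
    using assms(3) by (cases "total_length D = 0") (auto intro: powr_mono)
  then show "real (length S) * real (total_length D) powr (1 / 3 - \<epsilon>) + real (total_length D)
      \<le> real (length S) * real (total_length D) powr (1 / 3 - \<epsilon>') + real (total_length D)"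
    by (simp add: mult_left_mono)
qed

lemma restricted_hard:
  assumes "NFA_acceptance_hypothesis" "0 < \<gamma>" "\<gamma> < 3 / 2" "0 < \<epsilon>" "\<epsilon> < 1 / 3"
  shows "\<exists>c > 0. \<not> wb_solvable_fast (wb_instances_restricted \<gamma> c) \<epsilon>"
proof -
  define \<beta> where "\<beta> = 3 / \<gamma> - 1"
  have \<beta>: "1 < \<beta>" "(1 + \<beta>) * \<gamma> = 3" using assms(2,3) by (auto simp: \<beta>_def field_simps)
  define \<epsilon>' where "\<epsilon>' = min (3 * \<epsilon>) (\<beta> - 1) / (2 + \<beta>)"
  have "0 < \<epsilon>'" using assms(4) \<beta>(1) by (simp add: \<epsilon>'_def)
  then obtain c g where c: "0 < c" and g: "g \<longlonglongrightarrow> 0" and hard: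
      "\<not> solvable_in_time (nfa_instances_restricted 2 \<beta> c g) nfa_encoding (\<lambda>(M, x). nfa_accepts M x)
         (\<lambda>(M, x). (real (card (trans M)) * real (length x)) powr (1 - \<epsilon>'))"
    using assms(1)[unfolded NFA_acceptance_hypothesis_def, rule_format, of 2 \<beta> \<epsilon>'] \<beta>(1) by auto
  obtain A where A: "0 \<le> A" "\<And>n. 1 \<le> n \<Longrightarrow> real n powr g n \<le> A * real n"
    using linear_bound_of_o1[OF g] by blast
  \<comment> \<open>One constant dominates \<open>c\<close> for the given parameters,
    \<open>1 + A\<close> for \<open>R\<close>, and \<open>(3 + A) * c + 1\<close> for the sizes of
    text and dictionary.\<close>
  define K where "K = (4 + A) * (c + 1)"
  have K: "1 \<le> K" "c \<le> K" "1 + A \<le> K" "(3 + A) * c + 1 \<le> K"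
    using c A(1) by (auto simp: K_def algebra_simps)
  have "\<not> wb_solvable_fast (wb_instances_restricted \<gamma> (K * K powr \<gamma>)) \<epsilon>"
  proof
    assume "wb_solvable_fast (wb_instances_restricted \<gamma> (K * K powr \<gamma>)) \<epsilon>"
    then obtain P k C where P: "\<And>S D ys. (S, D) \<in> wb_instances_restricted \<gamma> (K * K powr \<gamma>) \<Longrightarrow>
        wb_encoding (S, D) ys \<Longrightarrow>
        \<exists>T. real T \<le> C * (1 + (real (length S) * real (total_length D) powr (1 / 3 - \<epsilon>)
                + real (total_length D))) \<and> decides P k ys (word_breakable D S) T"
      unfolding wb_solvable_fast_def solvable_in_time_def by fastforce
    \<comment> \<open>The summand \<open>2 * \<bar>C\<bar>\<close> comes from the constant 1 in the
      time bound, doubled by the embedding. The factor \<open>1 + 2 * \<bar>C\<bar>\<close> accounts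
      for the preprocessing and the doubled run.\<close>
    define C' where "C' = 2 * \<bar>C\<bar> + (1 + 2 * \<bar>C\<bar>) * (700 * K ^ 4)"
    have "\<exists>T. real T \<le> C' * (1 + (real (card (trans M)) * real (length x)) powr (1 - \<epsilon>')) \<and>
        decides (reduction P) (4 * k + 6) xs (nfa_accepts M x) T"
      if Mx: "(M, x) \<in> nfa_instances_restricted 2 \<beta> c g" and enc: "nfa_encoding (M, x) xs" for M x xs
    proof -
      define n where "n = card (states M)"
      define R where "R = n + card (alphabet M)"
      define S where "S = wb_text n R (start M) x"
      define D where "D = trans_word n R ` trans M \<union> final_word n ` final M"
      define t where "t = card (trans M)"
      have inst: "(M, x) \<in> nfa_instances" and t: "theta_bounded c (real t) (real n powr 2)"
        and l: "theta_bounded c (real (length x)) (real n powr \<beta>)"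
        and sg: "real (card (alphabet M)) \<le> real n powr g n"
        using Mx by (auto simp: nfa_instances_restricted_def n_def t_def Let_def)
      have n1: "1 \<le> n" using inst by (auto simp: nfa_instances_def wf_nfa_def n_def Suc_le_eq card_gt_0_iff)
      have x: "x \<noteq> []"
      proof
        assume "x = []"
        then show False using l n1 c by (simp add: theta_bounded_def divide_le_0_iff)
      qed
      note ctx = inst enc x n_def R_def S_def D_def
      let ?n = "real n" and ?l = "real (length x)" and ?t = "real t" and ?N = "real (length S)"
        and ?m = "real (total_length D)" and ?R = "real R"
      have l1: "1 \<le> ?l" using x by (cases x) auto
      have R: "?R \<le> (1 + A) * ?n" using sg A(2)[OF n1] by (simp add: R_def algebra_simps)
      also have "\<dots> \<le> K * ?n" using K by (intro mult_right_mono) auto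
      finally have RK: "?R \<le> K * ?n" .
      have div: "a / K \<le> a / c" if "0 \<le> a" for a using that c K by (intro divide_left_mono) auto
      have mul: "c * a \<le> K * a" if "0 \<le> a" for a using that K by (intro mult_right_mono) auto
      have lK: "?n powr \<beta> / K \<le> ?l" "?l \<le> K * ?n powr \<beta>"
        using l div[of "?n powr \<beta>"] mul[of "?n powr \<beta>"] by (auto simp: theta_bounded_def)
      have tK: "?n powr 2 / K \<le> ?t" "?t \<le> K * ?n powr 2"
        using t div[of "?n powr 2"] mul[of "?n powr 2"] by (auto simp: theta_bounded_def)
      have n\<beta>: "?n powr (1 + \<beta>) = ?n * ?n powr \<beta>" using n1 by (simp add: powr_add)
      have n3: "?n powr 3 = ?n * ?n powr 2" using n1 by (simp add: powr_numeral eval_nat_numeral)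
      have N: "?n powr (1 + \<beta>) / K \<le> ?N" "?N \<le> K * ?n powr (1 + \<beta>)"
      proof -
        have "?n powr (1 + \<beta>) / K \<le> ?n * ?l"
          using mult_left_mono[OF lK(1), of ?n] by (simp add: n\<beta>)
        also have "\<dots> \<le> ?N"
          using text_bounds(1)[OF ctx] by (simp flip: of_nat_mult)
        finally show "?n powr (1 + \<beta>) / K \<le> ?N" .
        have "?N \<le> real (n + length x * (R + n))" using text_bounds(3)[OF ctx] by (rule of_nat_mono)
        also have "\<dots> = ?n + ?l * (?R + ?n)" by simp
        also have "\<dots> \<le> ?l * ?n + ?l * ((1 + A) * ?n + ?n)"
          using l1 R n1 by (intro add_mono mult_left_mono) (auto simp: mult_le_cancel_right1)
        also have "\<dots> = (3 + A) * ?n * ?l" by (simp add: algebra_simps)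
        also have "\<dots> \<le> (3 + A) * ?n * (c * ?n powr \<beta>)"
          using l A(1) by (intro mult_left_mono) (auto simp: theta_bounded_def)
        also have "\<dots> = ((3 + A) * c) * ?n powr (1 + \<beta>)" by (simp add: n\<beta>)
        also have "\<dots> \<le> K * ?n powr (1 + \<beta>)" using K(4) by (intro mult_right_mono) auto
        finally show "?N \<le> K * ?n powr (1 + \<beta>)" .
      qed
      have m: "?n powr 3 / K \<le> ?m" "?m \<le> K * ?n powr 3"
      proof -
        have "?n powr 3 / K \<le> ?n * ?t"
          using mult_left_mono[OF tK(1), of ?n] by (simp add: n3)
        also have "\<dots> \<le> ?m"
          using dict_bounds(1)[OF ctx] by (simp add: t_def flip: of_nat_mult)
        finally show "?n powr 3 / K \<le> ?m" .
        have "?m \<le> real (t * (R + 2 * n) + n * n)"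
          unfolding t_def using dict_bounds(2)[OF ctx] by (rule of_nat_mono)
        also have "\<dots> = ?t * (?R + 2 * ?n) + ?n powr 2 * 1" by (simp add: power2_eq_square)
        also have "\<dots> \<le> (c * ?n powr 2) * ((1 + A) * ?n + 2 * ?n) + ?n powr 2 * ?n"
          using t R n1 c by (intro add_mono mult_mono mult_left_mono) (auto simp: theta_bounded_def)
        also have "\<dots> = ((3 + A) * c + 1) * ?n powr 3" by (simp add: n3 algebra_simps)
        also have "\<dots> \<le> K * ?n powr 3" using K(4) by (intro mult_right_mono) auto
        finally show "?m \<le> K * ?n powr 3" .
      qed
      have "(S, D) \<in> wb_instances_restricted \<gamma> (K * K powr \<gamma>)"
        using wb_instance[OF ctx] theta_bounded_powr[OF _ K(1) assms(2) \<beta>(2) N m] n1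
        by (simp add: wb_instances_restricted_def)
      note P = P[OF this]
      define f where "f = ?N * ?m powr (1 / 3 - \<epsilon>) + ?m"
      define F where "F = (?t * ?l) powr (1 - \<epsilon>')"
      have f: "f + 200 * (?l + ?t + ?n) * ?R \<le> 700 * K ^ 4 * F" "0 \<le> f"
        using time_bound[OF _ K(1) assms(4,5) \<beta>(1) \<epsilon>'_def _ N(2) _ m(2) lK tK _ RK] n1
        by (simp_all add: f_def F_def)
      have "\<exists>T. real T \<le> \<bar>C\<bar> * (1 + f) \<and> decides P k ys (word_breakable D S) T"
        if ys: "wb_encoding (S, D) ys" for ys
      proof -
        have "C * (1 + f) \<le> \<bar>C\<bar> * (1 + f)" using f(2) by (intro mult_right_mono) auto
        then show ?thesis using P[OF ys] unfolding f_def by (meson order_trans)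
      qed
      from transfer[OF ctx this]
      obtain T where T: "real T \<le> 200 * (?l + ?t + ?n) * ?R + 2 * (\<bar>C\<bar> * (1 + f))"
          "decides (reduction P) (4 * k + 6) xs (nfa_accepts M x) T"
        by (auto simp: t_def)
      have "0 \<le> 200 * (?l + ?t + ?n) * ?R" by simp
      then have "f \<le> 700 * K ^ 4 * F" using f(1) by linarith
      then have "\<bar>C\<bar> * f \<le> \<bar>C\<bar> * (700 * K ^ 4 * F)" by (rule mult_left_mono) simp
      then have "real T \<le> 700 * K ^ 4 * F + 2 * \<bar>C\<bar> + 2 * (\<bar>C\<bar> * (700 * K ^ 4 * F))"
        using T(1) f by (simp add: algebra_simps)
      also have "\<dots> = 2 * \<bar>C\<bar> + (1 + 2 * \<bar>C\<bar>) * (700 * K ^ 4) * F" by (simp add: algebra_simps)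
      also have "\<dots> \<le> C' + C' * F"
        unfolding C'_def using K(1) by (intro add_mono mult_right_mono) (auto simp: F_def)
      finally show ?thesis using T(2) by (auto simp: F_def t_def algebra_simps)
    qed
    then have "solvable_in_time (nfa_instances_restricted 2 \<beta> c g) nfa_encoding
        (\<lambda>(M, x). nfa_accepts M x)
        (\<lambda>(M, x). (real (card (trans M)) * real (length x)) powr (1 - \<epsilon>'))"
      unfolding solvable_in_time_def by (intro exI[of _ "reduction P"] exI[of _ "4 * k + 6"] exI[of _ C']) auto
    then show False using hard by contradiction
  qed
  moreover have "0 < K * K powr \<gamma>" using K(1) by simp
  ultimately show ?thesis by blast
qed

theorem theorem4p1:
  assumes "NFA_acceptance_hypothesis"
  shows "(\<forall>\<epsilon> > 0. \<not> wb_solvable_fast wb_instances \<epsilon>) \<and>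
         (\<forall>\<gamma>. 0 < \<gamma> \<and> \<gamma> < 3 / 2 \<longrightarrow>
            (\<forall>\<epsilon> > 0. \<exists>c > 0. \<not> wb_solvable_fast (wb_instances_restricted \<gamma> c) \<epsilon>))"
proof -
  have hard: "\<exists>c > 0. \<not> wb_solvable_fast (wb_instances_restricted \<gamma> c) \<epsilon>"
    if \<gamma>: "0 < \<gamma>" "\<gamma> < 3 / 2" and \<epsilon>: "0 < \<epsilon>" for \<gamma> \<epsilon>
  proof -
    \<comment> \<open>A larger \<open>\<epsilon>\<close> asks for a faster algorithm, so it suffices
      to refute some smaller value below \<open>1 / 3\<close>.\<close>
    have "0 < min \<epsilon> (1 / 6)" "min \<epsilon> (1 / 6) < 1 / 3" using \<epsilon> by linarith+
    from restricted_hard[OF assms \<gamma> this] obtain c where "c > 0"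
        "\<not> wb_solvable_fast (wb_instances_restricted \<gamma> c) (min \<epsilon> (1 / 6))" by blast
    then show ?thesis using wb_solvable_fast_mono[OF _ order_refl min.cobounded1] by blast
  qed
  \<comment> \<open>Hardness for a single admissible exponent, here 1, gives the unrestricted
    claim.\<close>
  have "wb_instances_restricted 1 c \<subseteq> wb_instances" for c
    by (auto simp: wb_instances_restricted_def)
  then have "\<not> wb_solvable_fast wb_instances \<epsilon>" if "0 < \<epsilon>" for \<epsilon>
    using hard[of 1 \<epsilon>] that wb_solvable_fast_mono[OF _ _ order_refl] by fastforce
  then show ?thesis using hard by blast
qed

end
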